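(* Let $d>1$ be a real number. There exists a unique function $f\colon\mathbb{R}\to[0,1]$ such that $$f(x)=\exp\left(-\int_{-x}^{+\infty}d\,(x+y)^{d-1}f(y)\,dy\right)\qquad\text{for all }x\in\mathbb{R}.$$ Moreover, for $0<\lambda<\infty$, let $f_\lambda\colon[-\lambda,\lambda]\to[0,1]$ denote the unique solution of the truncated equation $$f_\lambda(x)=\exp\left(-\int_{-x}^{\lambda}d\,(x+y)^{d-1}f_\lambda(y)\,dy\right)\qquad\text{for all }x\in[-\lambda,\lambda].$$ Then $f_\lambda\to f$ pointwise as $\lambda\to+\infty$ (that is, $f_\lambda(x)\to f(x)$ for every $x\in\mathbb{R}$), and $$\int_{-\lambda}^{\lambda}f_\lambda(x)\ln f_\lambda(x)\,dx\ \xrightarrow[\lambda\to+\infty]{}\ \int_{\mathbb{R}}f(x)\ln f(x)\,dx.$$ Consequently, the two quantities $-d\int_{\mathbb{R}}f(x)\ln f(x)\,dx$ and $\lim_{\lambda\to+\infty}\left(-d\int_{-\lambda}^{\lambda}f_\lambda(x)\ln f_\lambda(x)\,dx\right)$ coincide.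
   Context: All functions are understood to be Lebesgue measurable. The integrals inside the exponentials have non-negative integrands and are understood with values in $[0,+\infty]$, with $\exp(-\infty)=0$. For each $0<\lambda<\infty$ and $d>1$, the truncated equation is known to have exactly one solution $f_\lambda\colon[-\lambda,\lambda]\to[0,1]$, and it is non-increasing. For fixed $x\in\mathbb{R}$, $f_\lambda(x)$ is defined as soon as $\lambda\ge|x|$; equivalently one may extend $f_\lambda$ to $\mathbb{R}$ by $f_\lambda(x)=1$ for $x\le-\lambda$ and $f_\lambda(x)=0$ for $x>\lambda$. *)

theory Defs
  imports "HOL-Analysis.Analysis"
begin

definition exp_neg :: "ennreal \<Rightarrow> real" where
  "exp_neg t = (if t = \<infinity> then 0 else exp (- enn2real t))"

definition cavity_solution :: "real \<Rightarrow> (real \<Rightarrow> real) \<Rightarrow> bool" where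
  "cavity_solution d f \<longleftrightarrow>
     f \<in> UNIV \<rightarrow> {0..1} \<and>
     f \<in> borel_measurable lebesgue \<and>
     (\<forall>x. f x = exp_neg (\<integral>\<^sup>+y\<in>{-x..}. ennreal (d * (x + y) powr (d - 1) * f y) \<partial>lebesgue))"

text \<open>
  A function on the interval from \<open>-l\<close> to \<open>l\<close> is encoded extensionally (it is \<open>undefined\<close>
  elsewhere), so that uniqueness is equality in the function type. For \<open>x\<close> in that interval the
  domain of integration \<open>{-x..l}\<close> stays inside it.
\<close>

definition truncated_solution :: "real \<Rightarrow> real \<Rightarrow> (real \<Rightarrow> real) \<Rightarrow> bool" where
  "truncated_solution d l g \<longleftrightarrow>
     g \<in> {-l..l} \<rightarrow>\<^sub>E {0..1} \<and>
     g \<in> borel_measurable (lebesgue_on {-l..l}) \<and>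
     (\<forall>x\<in>{-l..l}.
        g x = exp_neg (\<integral>\<^sup>+y\<in>{-x..l}. ennreal (d * (x + y) powr (d - 1) * g y) \<partial>lebesgue))"

end

theory Submission
  imports Defs "HOL-Probability.Helly_Selection"
begin

text \<open>
  Write \<open>K f x\<close> for the exponent in the cavity equation; it is monotone in \<open>f\<close>, and shifting \<open>x\<close> by
  \<open>t\<close> amounts to shifting \<open>f\<close> by \<open>-t\<close>. Extend a truncated solution by 1 on the left and 0 on the right.

  A priori bounds: with \<open>b = K f 0\<close>, monotonicity of the kernel gives
  \<open>K f x \<ge> b + exp (-b) * x^d\<close> for \<open>x \<ge> 0\<close>; inserting this into \<open>b = \<integral> d y^(d-1) f y\<close> yields \<open>b \<le> 1\<close>. Hence
  all solutions, truncated or not, obey the same bounds \<open>f x \<le> exp (-x^d / e)\<close> for \<open>x \<ge> 0\<close> and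
  \<open>1 - f x \<le> K f x \<le> e * exp (-\<bar>x\<bar>^d / e)\<close> for \<open>x \<le> 0\<close>.

  Uniqueness: an inequality \<open>f (x + t) \<le> g x\<close> for all \<open>x\<close> reproduces itself under the equation with the
  roles of \<open>f\<close> and \<open>g\<close> exchanged, and the least admissible \<open>t\<close> must be 0, because for \<open>t > 0\<close> the
  inequality between the exponents is strict. On the whole line this needs control at infinity, where
  \<open>K f (x + t) - K g x\<close> is asymptotically \<open>d x^(d-1) (s f - s g + t)\<close>, with \<open>s f\<close> the integral of \<open>f\<close>
  minus the indicator of the negative half-line.

  A truncated solution is a least fixed point of the squared (monotone) operator on non-increasing
  functions. By Helly's theorem and dominated convergence the truncated solutions subconverge to
  solutions on the line, which uniqueness upgrades to convergence.
\<close>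

subsection \<open>The kernel and its potential\<close>

locale pseudo_dimension =
  fixes d :: real
  assumes d_gt_1: "d > 1"
begin

text \<open>Cutting the power off at 0 encodes the lower limit \<open>-x\<close> of the cavity
  integral, so that all integrals run over the whole line.\<close>

definition kern :: "real \<Rightarrow> real" where
  "kern s = d * max 0 s powr (d - 1)"

definition pot :: "(real \<Rightarrow> real) \<Rightarrow> real \<Rightarrow> real" where
  "pot w x = (\<integral>y. kern (x + y) * w y \<partial>lborel)"

text \<open>A divergent Bochner integral is 0 by default, so finiteness has to be recorded before
  \<open>pot\<close> can stand for the exponent.\<close>

definition tame :: "(real \<Rightarrow> real) \<Rightarrow> bool" where
  "tame w \<longleftrightarrow> w \<in> borel_measurable borel \<and> (\<forall>x. 0 \<le> w x \<and> w x \<le> 1) \<and>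
     (\<forall>x. integrable lborel (\<lambda>y. kern (x + y) * w y))"

lemma kern_nonneg [simp]: "0 \<le> kern s"
  using d_gt_1 by (simp add: kern_def)

lemma kern_eq_0 [simp]: "s \<le> 0 \<Longrightarrow> kern s = 0"
  by (simp add: kern_def)

lemma kern_pos: "s > 0 \<Longrightarrow> kern s > 0"
  using d_gt_1 by (simp add: kern_def)

lemma kern_mono: "s \<le> t \<Longrightarrow> kern s \<le> kern t"
  unfolding kern_def using d_gt_1 by (intro mult_left_mono powr_mono2) auto

lemma continuous_on_kern: "continuous_on UNIV kern"
  unfolding kern_def using d_gt_1 by (intro continuous_intros continuous_on_powr') auto

lemma isCont_kern: "isCont kern s"
  using continuous_on_kern by (simp add: continuous_on_eq_continuous_at)

lemma kern_measurable [measurable]: "kern \<in> borel_measurable borel"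
  by (rule borel_measurable_continuous_onI[OF continuous_on_kern])

lemma DERIV_max_powr: "((\<lambda>y. max 0 y powr d) has_real_derivative kern y) (at y)"
proof -
  consider "y > 0" | "y < 0" | "y = 0" by linarith
  then show ?thesis
  proof cases
    case 1
    have "((\<lambda>y. y powr d) has_real_derivative kern y) (at y)"
      unfolding kern_def using 1 by (auto intro!: derivative_eq_intros)
    then show ?thesis
      by (rule DERIV_cong_ev[THEN iffD1, rotated 3])
         (use 1 eventually_nhds_in_open[of "{0<..}" y] in \<open>auto elim!: eventually_mono\<close>)
  next
    case 2
    have "((\<lambda>y. 0) has_real_derivative kern y) (at y)"
      using 2 by simp
    then show ?thesis
      by (rule DERIV_cong_ev[THEN iffD1, rotated 3])
         (use 2 eventually_nhds_in_open[of "{..<0}" y] in \<open>auto elim!: eventually_mono\<close>)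
  next
    case 3
    \<comment> \<open>At the origin the difference quotient is itself a multiple of
      \<open>kern\<close>, so differentiability reduces to continuity of \<open>kern\<close>, where
      d > 1 enters.\<close>
    have q: "(max 0 h powr d) / h = kern h / d" for h :: real
      using d_gt_1 by (cases "h > 0") (auto simp: kern_def powr_diff max_def)
    have "(\<lambda>h. kern h / d) \<midarrow>0\<rightarrow> kern 0 / d"
      using isCont_kern[of 0] d_gt_1 unfolding isCont_def by (intro tendsto_intros) auto
    then show ?thesis
      using 3 by (simp add: DERIV_def q)
  qed
qed

lemma kern_integral:
  assumes "a \<le> b"
  shows "has_bochner_integral lborel (\<lambda>y. kern (x + y) * indicator {a..b} y)
    (max 0 (x + b) powr d - max 0 (x + a) powr d)"
proof -
  have D: "((\<lambda>y. max 0 (x + y) powr d) has_real_derivative kern (x + y)) (at y)" for y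
  proof -
    have "((\<lambda>y. x + y) has_real_derivative 1) (at y)"
      by (auto intro!: derivative_eq_intros)
    from DERIV_chain2[OF DERIV_max_powr this] show ?thesis by simp
  qed
  have "isCont (\<lambda>y. kern (x + y)) y" for y
    by (rule isCont_o2[OF _ isCont_kern]) (auto intro!: continuous_intros)
  then show ?thesis
    using has_bochner_integral_FTC_Icc_real[OF assms, of "\<lambda>y. max 0 (x + y) powr d" "\<lambda>y. kern (x + y)"] D
    by (auto simp: ac_simps)
qed

text \<open>\<open>kern\<close> is the derivative of y^d (cut off at 0), so the integrand has the
  antiderivative -exp (-a y^d) / a. The exact value later yields \<open>b \<le> 1\<close> in the a
  priori bounds.\<close>

lemma tail_integral:
  assumes a: "a > 0"
  shows "has_bochner_integral lborel
    (\<lambda>y. indicator {p..} y * (kern y * exp (- a * max 0 y powr d))) (exp (- a * max 0 p powr d) / a)"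
proof (rule has_bochner_integral_nn_integral)
  have lim: "((\<lambda>y. - (exp (- a * max 0 y powr d) / a)) \<longlongrightarrow> - (0 / a)) at_top"
  proof (intro tendsto_intros filterlim_compose[OF exp_at_bot])
    have "filterlim (\<lambda>y. max 0 y powr d) at_top at_top"
    proof (rule filterlim_at_top_mono)
      show "filterlim (\<lambda>y::real. y) at_top at_top" by (rule filterlim_ident)
      show "\<forall>\<^sub>F y in at_top. y \<le> max 0 y powr d"
        using eventually_ge_at_top[of 1]
      proof eventually_elim
        case (elim y)
        then show ?case using d_gt_1 powr_mono[of 1 d y] by auto
      qed
    qed
    then show "LIM y at_top. - a * max 0 y powr d :> at_bot"
      using a by (subst filterlim_tendsto_neg_mult_at_bot_iff[OF tendsto_const]) auto
  qed (use a in auto)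
  have D: "((\<lambda>y. - (exp (- a * max 0 y powr d) / a)) has_real_derivative
      kern y * exp (- a * max 0 y powr d)) (at y)" for y
  proof -
    have "((\<lambda>y. - (exp (- a * P y) / a)) has_real_derivative k * exp (- a * P y)) (at y)"
      if "(P has_real_derivative k) (at y)" for P k
      using that a by (auto intro!: derivative_eq_intros)
    from this[OF DERIV_max_powr] show ?thesis .
  qed
  have "(\<integral>\<^sup>+y. ennreal (kern y * exp (- a * max 0 y powr d)) * indicator {p..} y \<partial>lborel) =
      - (0 / a) - (- (exp (- a * max 0 p powr d) / a))"
    by (rule nn_integral_FTC_atLeast[OF _ D _ lim]) auto
  then show "(\<integral>\<^sup>+y. ennreal (indicator {p..} y * (kern y * exp (- a * max 0 y powr d))) \<partial>lborel) =
      ennreal (exp (- a * max 0 p powr d) / a)"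
    by (simp add: ennreal_mult'' ennreal_indicator mult.commute)
qed (use a in auto)

section \<open>Monotonicity, translation and continuity of the potential\<close>

lemma tameD:
  assumes "tame w"
  shows "w \<in> borel_measurable borel" "0 \<le> w x" "w x \<le> 1"
    "integrable lborel (\<lambda>y. kern (x + y) * w y)"
  using assms by (auto simp: tame_def)

lemma tameI_support:
  assumes [measurable]: "w \<in> borel_measurable borel"
    and w: "\<And>x. 0 \<le> w x" "\<And>x. w x \<le> 1" and supp: "\<And>x. x > l \<Longrightarrow> w x = 0"
  shows "tame w"
  unfolding tame_def
proof (intro conjI allI)
  fix x
  show "integrable lborel (\<lambda>y. kern (x + y) * w y)"
  proof (rule Bochner_Integration.integrable_bound)
    show "integrable lborel (\<lambda>y. kern (x + y) * indicator {- x..max (- x) l} y)"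
      using kern_integral[of "- x" "max (- x) l" x] by (auto simp: has_bochner_integral_iff)
    show "AE y in lborel. norm (kern (x + y) * w y) \<le> norm (kern (x + y) * indicator {- x..max (- x) l} y)"
    proof (intro AE_I2)
      fix y
      show "norm (kern (x + y) * w y) \<le> norm (kern (x + y) * indicator {- x..max (- x) l} y)"
        using w[of y] supp[of y] mult_left_le[of "w y" "kern (x + y)"]
        by (cases "y < - x"; cases "y > l") (auto simp: abs_mult indicator_def)
    qed
  qed simp
qed (use w in auto)

lemma pot_nonneg: "tame w \<Longrightarrow> 0 \<le> pot w x"
  unfolding pot_def by (intro integral_nonneg_AE AE_I2) (auto simp: tame_def)

lemma pot_mono: "tame w \<Longrightarrow> x \<le> x' \<Longrightarrow> pot w x \<le> pot w x'"
  unfolding pot_def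
  by (intro integral_mono mult_right_mono kern_mono) (auto simp: tame_def)

lemma pot_mono_fun:
  assumes "tame u" "tame v" "\<And>y. v y \<le> u y"
  shows "pot v x \<le> pot u x"
  unfolding pot_def using assms
  by (intro integral_mono mult_left_mono) (auto simp: tame_def)

lemma pot_shift:
  assumes "tame w"
  shows "integrable lborel (\<lambda>y. kern (x + y) * w (y - t))"
    and "pot w (x + t) = (\<integral>y. kern (x + y) * w (y - t) \<partial>lborel)"
proof -
  have i: "integrable lborel (\<lambda>y. kern (x + t + y) * w y)"
    using assms by (auto simp: tame_def)
  show "integrable lborel (\<lambda>y. kern (x + y) * w (y - t))"
    using lborel_integrable_real_affine[OF i, of 1 "- t"] by (simp add: algebra_simps)
  show "pot w (x + t) = (\<integral>y. kern (x + y) * w (y - t) \<partial>lborel)"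
    unfolding pot_def using lborel_integral_real_affine[of 1 "\<lambda>y. kern (x + t + y) * w y" "- t"]
    by (simp add: algebra_simps)
qed

text \<open>Points left of \<open>-x\<close> are invisible to the kernel at \<open>x\<close>. This
  is how a comparison of functions far to the right controls potentials far to the left.\<close>

lemma kern_mult_le:
  assumes "y \<ge> - x \<Longrightarrow> a \<le> b"
  shows "kern (x + y) * a \<le> kern (x + y) * b"
  using assms by (cases "y \<ge> - x") (auto intro: mult_left_mono)

lemma pot_le_shift:
  assumes "tame u" "tame v" "\<And>y. y \<ge> - x \<Longrightarrow> v y \<le> u (y - t)"
  shows "pot v x \<le> pot u (x + t)"
  unfolding pot_shift(2)[OF assms(1)] unfolding pot_def using assms
  by (intro integral_mono pot_shift kern_mult_le) (auto simp: tame_def)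

text \<open>Equal integrals would force the non-negative difference of the integrands to vanish
  almost everywhere. Between \<open>p\<close> and \<open>q\<close> it is positive, because
  \<open>-x \<le> p\<close> keeps the kernel positive there.\<close>

lemma pot_less_shift:
  assumes "tame u" "tame v" "\<And>y. y \<ge> - x \<Longrightarrow> v y \<le> u (y - t)"
    and pq: "p < q" "- x \<le> p" "\<And>y. p < y \<Longrightarrow> y < q \<Longrightarrow> v y < u (y - t)"
  shows "pot v x < pot u (x + t)"
proof (rule ccontr)
  assume "\<not> pot v x < pot u (x + t)"
  with pot_le_shift[OF assms(1-3)] have eq: "pot u (x + t) - pot v x = 0" by force
  have i: "integrable lborel (\<lambda>y. kern (x + y) * u (y - t) - kern (x + y) * v y)"
    using pot_shift(1)[OF assms(1)] assms(2) by (auto simp: tame_def)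
  have "AE y in lborel. kern (x + y) * u (y - t) - kern (x + y) * v y = 0"
  proof (subst integral_nonneg_eq_0_iff_AE[OF i, symmetric])
    show "AE y in lborel. 0 \<le> kern (x + y) * u (y - t) - kern (x + y) * v y"
      using assms(3) kern_mult_le by (auto simp del: kern_eq_0)
    show "(\<integral>y. kern (x + y) * u (y - t) - kern (x + y) * v y \<partial>lborel) = 0"
      using eq pot_shift[OF assms(1), of x t] assms(2)
      by (subst Bochner_Integration.integral_diff) (auto simp: tame_def pot_def)
  qed
  then have "AE y in lborel. y \<notin> {p<..<q}"
  proof eventually_elim
    case (elim y)
    then show ?case
      using pq(2) pq(3)[of y] kern_pos[of "x + y"] by auto
  qed
  then have "emeasure lborel {p<..<q} = 0"
    by (subst (asm) AE_iff_measurable[OF _ refl])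
       (auto simp: greaterThanLessThan_def greaterThan_def lessThan_def Int_def)
  with pq(1) show False by simp
qed

lemma isCont_pot:
  assumes w: "tame w"
  shows "isCont (pot w) x"
proof (rule continuous_at_sequentiallyI)
  fix X :: "nat \<Rightarrow> real" assume X: "X \<longlonglongrightarrow> x"
  have m [measurable]: "w \<in> borel_measurable borel" by (rule tameD[OF w])
  \<comment> \<open>The convergent sequence is bounded by some \<open>R\<close>, and monotonicity of
    the kernel makes \<open>kern (R + y) * w y\<close> a common majorant.\<close>
  obtain R where R: "\<And>n. X n \<le> R"
    using BseqE[OF convergent_imp_Bseq[OF convergentI[OF X]]] by (metis abs_le_D1 real_norm_def)
  show "(\<lambda>n. pot w (X n)) \<longlonglongrightarrow> pot w x"
    unfolding pot_def
  proof (rule integral_dominated_convergence)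
    show "integrable lborel (\<lambda>y. kern (R + y) * w y)" by (rule tameD[OF w])
    show "AE y in lborel. (\<lambda>n. kern (X n + y) * w y) \<longlonglongrightarrow> kern (x + y) * w y"
      by (intro AE_I2 tendsto_intros isCont_tendsto_compose[OF isCont_kern] X)
    show "AE y in lborel. norm (kern (X n + y) * w y) \<le> kern (R + y) * w y" for n
      using R[of n] tameD[OF w] by (auto simp: abs_mult intro!: AE_I2 mult_right_mono kern_mono)
  qed auto
qed

lemma continuous_on_pot: "tame w \<Longrightarrow> continuous_on S (pot w)"
  by (meson continuous_at_imp_continuous_on isCont_pot)

section \<open>Sets of admissible shifts: closedness and lowering\<close>

lemma closed_pot_shift:
  assumes "tame u"
  shows "closed {t. \<forall>x\<in>K. a x \<le> pot u (x + t)}"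
proof -
  have "continuous_on UNIV (\<lambda>t. pot u (x + t))" for x
    by (rule continuous_on_compose2[OF continuous_on_pot[OF assms, of UNIV]]) (auto intro!: continuous_intros)
  then have "closed {t. a x \<le> pot u (x + t)}" for x
    by (intro closed_Collect_le) (auto intro!: continuous_intros)
  then have "closed (\<Inter>x\<in>K. {t. a x \<le> pot u (x + t)})" by blast
  then show ?thesis by (simp add: Collect_ball_eq)
qed

text \<open>Compactness turns the strict inequality into a gap \<open>e\<close>, and uniform
  continuity lets the shift drop a little without using up the gap. Monotonicity of
  \<open>pot\<close> covers all larger shifts, so two such statements can be combined by a
  maximum.\<close>

lemma pot_shift_smaller:
  assumes "tame u" "tame v" "r < t" "\<And>x. x \<in> {p..q} \<Longrightarrow> pot v x < pot u (x + t)"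
  shows "\<exists>s. r < s \<and> s < t \<and> (\<forall>s'\<ge>s. \<forall>x\<in>{p..q}. pot v x \<le> pot u (x + s'))"
proof (cases "p \<le> q")
  case False
  then show ?thesis using dense[OF assms(3)] by auto
next
  case True
  have "continuous_on {p..q} (\<lambda>x. pot u (x + t) - pot v x)"
    by (intro continuous_on_diff continuous_on_pot assms
        continuous_on_compose2[OF continuous_on_pot[OF assms(1), of UNIV]])
       (auto intro!: continuous_intros)
  from continuous_attains_inf[OF _ _ this] True
  obtain x0 where x0: "x0 \<in> {p..q}"
    "\<And>x. x \<in> {p..q} \<Longrightarrow> pot u (x0 + t) - pot v x0 \<le> pot u (x + t) - pot v x"
    by auto
  define e where "e = pot u (x0 + t) - pot v x0"
  have e: "e > 0" using assms(4)[OF x0(1)] by (simp add: e_def)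
  have "uniformly_continuous_on {p+r..q+t} (pot u)"
    by (intro compact_uniformly_continuous continuous_on_pot assms) auto
  then obtain \<delta> where \<delta>: "\<delta> > 0" "\<And>x x'. x \<in> {p+r..q+t} \<Longrightarrow> x' \<in> {p+r..q+t} \<Longrightarrow>
      dist x' x < \<delta> \<Longrightarrow> dist (pot u x') (pot u x) < e"
    using e unfolding uniformly_continuous_on_def by meson
  \<comment> \<open>The midpoint keeps \<open>s\<close> above \<open>r\<close>; the other term keeps
    it within \<open>\<delta>\<close> of \<open>t\<close>.\<close>
  define s where "s = max ((r + t) / 2) (t - \<delta> / 2)"
  have s: "r < s" "s < t" "t - s < \<delta>" using \<delta>(1) assms(3) by (auto simp: s_def max_def field_simps)
  have "pot v x \<le> pot u (x + s')" if "x \<in> {p..q}" "s' \<ge> s" for x s'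
  proof -
    have "dist (pot u (x + s)) (pot u (x + t)) < e"
      using s that by (intro \<delta>(2)) (auto simp: dist_real_def)
    then have "pot v x \<le> pot u (x + s)"
      using x0(2)[OF that(1)] unfolding e_def[symmetric] dist_real_def by linarith
    also have "\<dots> \<le> pot u (x + s')" using that by (intro pot_mono assms) auto
    finally show ?thesis .
  qed
  then show ?thesis using s by blast
qed

end

text \<open>The skeleton of both sliding arguments: closedness makes the infimum a member, and a
  positive member is never the least.\<close>

lemma closed_shift_set_contains_0:
  fixes S :: "real set"
  assumes "closed S" "S \<noteq> {}" "S \<subseteq> {0..}" "\<And>t. t \<in> S \<Longrightarrow> t > 0 \<Longrightarrow> \<exists>s\<in>S. s < t"
  shows "0 \<in> S"
proof -
  have bb: "bdd_below S" using assms(3) by (auto simp: bdd_below_def)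
  have "Inf S \<in> S" by (rule closed_contains_Inf[OF assms(2) bb assms(1)])
  moreover have "\<not> Inf S > 0"
    using assms(4)[OF calculation] cInf_lower[OF _ bb] by force
  ultimately show ?thesis using assms(3) by (cases "Inf S = 0") auto
qed

lemma antimono_borel_measurable:
  fixes f :: "real \<Rightarrow> real"
  assumes "antimono f"
  shows "f \<in> borel_measurable borel"
proof -
  have "mono (\<lambda>x. - f x)"
    using assms by (auto simp: antimono_def mono_def)
  then show ?thesis
    using borel_measurable_mono[of "\<lambda>x. - f x"] by simp
qed

context pseudo_dimension
begin

subsection \<open>Truncated solutions and a priori bounds\<close>

text \<open>Taking \<open>A\<close> to be \<open>{..l}\<close> or \<open>UNIV\<close> treats both
  equations at once. For \<open>{..l}\<close> the extension by 1 is automatic: functions vanishing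
  beyond \<open>l\<close> have potential 0 left of \<open>-l\<close>.\<close>

definition cavity_op :: "real set \<Rightarrow> (real \<Rightarrow> real) \<Rightarrow> real \<Rightarrow> real" where
  "cavity_op A w x = indicator A x * exp (- pot w x)"

definition solves :: "real set \<Rightarrow> (real \<Rightarrow> real) \<Rightarrow> bool" where
  "solves A f \<longleftrightarrow> tame f \<and> f = cavity_op A f"

lemma cavity_op_bounds:
  assumes "tame w"
  shows "0 \<le> cavity_op A w x" "cavity_op A w x \<le> 1"
  using pot_nonneg[OF assms, of x] by (auto simp: cavity_op_def indicator_def)

lemma antimono_cavity_op:
  assumes "tame w" "\<And>x y. x \<le> y \<Longrightarrow> y \<in> A \<Longrightarrow> x \<in> A"
  shows "antimono (cavity_op A w)"
proof (rule antimonoI)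
  fix x y :: real assume "x \<le> y"
  then show "cavity_op A w y \<le> cavity_op A w x"
    using pot_mono[OF assms(1), of x y] assms(2)[of x y] by (auto simp: cavity_op_def indicator_def)
qed

lemma cavity_op_antimono:
  assumes "tame u" "tame v" "\<And>y. v y \<le> u y"
  shows "cavity_op A u x \<le> cavity_op A v x"
  using pot_mono_fun[OF assms, of x] by (auto simp: cavity_op_def indicator_def)

lemma tame_antimono_support:
  assumes "antimono w" "\<And>x. 0 \<le> w x" "\<And>x. w x \<le> 1" "\<And>x. x > l \<Longrightarrow> w x = 0"
  shows "tame w"
  using assms tameI_support antimono_borel_measurable by blast

lemma pot_eq_0:
  assumes "\<And>y. y > l \<Longrightarrow> w y = 0" "x \<le> - l"
  shows "pot w x = 0"
proof -
  have z: "kern (x + y) * w y = 0" for y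
    using assms by (cases "y > l") auto
  then show ?thesis unfolding pot_def by (simp only: z) simp
qed

lemma solvesD:
  assumes "solves A f"
  shows "tame f" "f x = indicator A x * exp (- pot f x)"
proof -
  show "tame f" using assms unfolding solves_def by (rule conjunct1)
  have "f = cavity_op A f" using assms unfolding solves_def by (rule conjunct2)
  from fun_cong[OF this, of x] show "f x = indicator A x * exp (- pot f x)"
    unfolding cavity_op_def .
qed

lemma solvesI:
  assumes "tame f" "\<And>x. f x = indicator A x * exp (- pot f x)"
  shows "solves A f"
  unfolding solves_def cavity_op_def using assms by blast

lemma solves_antimono:
  assumes "solves A f" "\<And>x y. x \<le> y \<Longrightarrow> y \<in> A \<Longrightarrow> x \<in> A"
  shows "antimono f"
proof -
  have "antimono (cavity_op A f)"
    by (rule antimono_cavity_op[OF solvesD(1)[OF assms(1)]]) (rule assms(2))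
  moreover have "cavity_op A f = f"
    using assms(1) unfolding solves_def by (metis)
  ultimately show ?thesis by simp
qed

text \<open>An inequality between the exponents at shift \<open>t\<close> gives
  \<open>v (x + t) \<le> u x\<close>, which integrates back to the same inequality, strictly if
  \<open>t > 0\<close>; so the least admissible shift is 0. The two-function form serves existence
  (a pair exchanged by the operator) as well as uniqueness (minimum and maximum of two
  solutions).\<close>

lemma truncated_compare:
  assumes l: "l > 0" and tu: "tame u" and tv: "tame v"
    and supp: "\<And>x. x > l \<Longrightarrow> u x = 0" "\<And>x. x > l \<Longrightarrow> v x = 0"
    and uv: "\<And>x. x \<le> l \<Longrightarrow> exp (- pot v x) \<le> u x" "\<And>x. x \<le> l \<Longrightarrow> v x \<le> exp (- pot u x)"
  shows "v x \<le> u x"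
proof -
  have u1: "u x = 1" if "x \<le> - l" for x
    using uv(1)[of x] pot_eq_0[of l v x] supp(2) tameD(3)[OF tu, of x] that l by simp
  \<comment> \<open>A compact range of \<open>x\<close> suffices: left of it \<open>u\<close> is 1,
    and beyond \<open>l\<close> the function \<open>v\<close> is 0.\<close>
  define S where "S = {t. \<forall>x\<in>{-l..l}. pot v x \<le> pot u (x + t)} \<inter> {0..}"
  have shift: "v (x + t) \<le> u x" if tS: "t \<in> S" for x t
  proof -
    consider "x < - l" | "x + t > l" | "x \<in> {-l..l}" "x + t \<le> l" "t \<ge> 0"
      using tS by (force simp: S_def)
    then show ?thesis
    proof cases
      case 3
      have "v (x + t) \<le> exp (- pot u (x + t))" using 3 by (intro uv) auto
      also have "\<dots> \<le> exp (- pot v x)" using tS 3 by (simp add: S_def)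
      also have "\<dots> \<le> u x" using 3 by (intro uv) auto
      finally show ?thesis .
    qed (use supp u1 tameD[OF tu] tameD[OF tv] in auto)
  qed
  have "0 \<in> S"
  proof (rule closed_shift_set_contains_0)
    show "closed S"
      unfolding S_def by (intro closed_Int closed_pot_shift tu) auto
    \<comment> \<open>The shift \<open>2 * l\<close> moves every \<open>y \<le> l\<close> to the
      region where \<open>u\<close> is 1.\<close>
    have "pot v x \<le> pot u (x + 2 * l)" for x
    proof (rule pot_le_shift[OF tu tv])
      fix y
      show "v y \<le> u (y - 2 * l)"
        using supp(2)[of y] u1[of "y - 2 * l"] tameD(2)[OF tu] tameD(3)[OF tv, of y]
        by (cases "y > l") auto
    qed
    then have "2 * l \<in> S" using l by (auto simp: S_def)
    then show "S \<noteq> {}" by blast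
    show "S \<subseteq> {0..}" by (auto simp: S_def)
    fix t assume t: "t \<in> S" "t > 0"
    have "pot v x < pot u (x + t)" if "x \<in> {-l..l}" for x
    proof (rule pot_less_shift[OF tu tv, of _ _ l "l + t"])
      show "v y \<le> u (y - t)" for y using shift[OF t(1), of "y - t"] by simp
      \<comment> \<open>Strictness comes from the edge: just beyond \<open>l\<close> the function
        \<open>v\<close> is already 0, while the shifted \<open>u\<close> is still positive.\<close>
      show "v y < u (y - t)" if "l < y" "y < l + t" for y
        using supp(2)[of y] that less_le_trans[OF exp_gt_zero uv(1), of "y - t"] by simp
    qed (use t that in auto)
    from pot_shift_smaller[OF tu tv t(2) this]
    show "\<exists>s\<in>S. s < t" by (force simp: S_def)
  qed
  from shift[OF this, of x] show ?thesis by simp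
qed

text \<open>The operator reverses order, so its square preserves order and has a least fixed point
  \<open>u\<close> by the Knaster-Tarski construction. The operator exchanges \<open>u\<close> and
  its image \<open>v\<close>, and comparing them both ways shows that they coincide.\<close>

lemma truncated_exists:
  assumes l: "l > 0"
  shows "\<exists>f. solves {..l} f"
proof -
  let ?T = "cavity_op {..l}"
  \<comment> \<open>An infimum of arbitrarily many measurable functions may fail to be measurable;
    an infimum of non-increasing functions is again non-increasing.\<close>
  define W where "W = {w :: real \<Rightarrow> real. antimono w \<and> (\<forall>x. 0 \<le> w x) \<and> (\<forall>x. w x \<le> 1) \<and> (\<forall>x>l. w x = 0)}"
  have W_tame: "tame w" if "w \<in> W" for w
    using that by (intro tame_antimono_support) (auto simp: W_def)
  have T_W: "?T w \<in> W" if "tame w" for w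
    using antimono_cavity_op[OF that, of "{..l}"] cavity_op_bounds[OF that]
    by (auto simp: W_def) (simp add: cavity_op_def)
  have TT_mono: "?T (?T v) x \<le> ?T (?T u) x" if "v \<in> W" "u \<in> W" "\<And>y. v y \<le> u y" for u v x
    using that by (intro cavity_op_antimono W_tame T_W)
  define M where "M = {w \<in> W. \<forall>x. ?T (?T w) x \<le> w x}"
  define u where "u x = (INF w\<in>M. w x)" for x
  \<comment> \<open>This is the greatest element of \<open>W\<close>, hence a member of
    \<open>M\<close>, so the infimum runs over a non-empty family.\<close>
  have "indicator {..l} \<in> W"
    using l by (auto simp: W_def antimono_def indicator_def)
  moreover from this have "?T (?T (indicator {..l})) x \<le> indicator {..l} x" for x
    using T_W[OF W_tame[OF T_W[OF W_tame[OF \<open>indicator {..l} \<in> W\<close>]]]]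
    by (cases "x \<le> l") (auto simp: W_def)
  ultimately have ind: "indicator {..l} \<in> M"
    by (simp add: M_def)
  have bdd: "bdd_below ((\<lambda>w. w x) ` M)" for x
    by (rule bdd_belowI[of _ 0]) (auto simp: M_def W_def)
  have u_le: "u x \<le> w x" if "w \<in> M" for w x
    unfolding u_def by (rule cINF_lower[OF bdd that])
  have u_ge: "c \<le> u x" if "\<And>w. w \<in> M \<Longrightarrow> c \<le> w x" for c x
    unfolding u_def using ind that by (intro cINF_greatest) auto
  have uW: "u \<in> W"
    unfolding W_def
  proof (intro CollectI conjI allI impI)
    show "antimono u"
    proof (rule antimonoI, rule u_ge)
      fix x y w assume "x \<le> (y::real)" "w \<in> M"
      then show "u y \<le> w x"
        using u_le[of w y] by (auto simp: M_def W_def dest: antimonoD[of w x y])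
    qed
    show "0 \<le> u x" for x by (rule u_ge) (auto simp: M_def W_def)
    show "u x \<le> 1" for x by (rule order_trans[OF u_le[OF ind]]) (simp add: indicator_le_1)
    show "u x = 0" if "x > l" for x
      using u_le[OF ind, of x] \<open>0 \<le> u x\<close> that by simp
  qed
  define v where "v = ?T u"
  have vW: "v \<in> W" unfolding v_def by (intro T_W W_tame uW)
  have Tv_le: "?T v x \<le> u x" for x
  proof (rule u_ge)
    fix w assume w: "w \<in> M"
    then have "?T v x \<le> ?T (?T w) x"
      unfolding v_def using u_le[OF w] by (intro TT_mono uW) (auto simp: M_def)
    also have "\<dots> \<le> w x" using w by (auto simp: M_def)
    finally show "?T v x \<le> w x" .
  qed
  have "?T v \<in> M"
    unfolding M_def
  proof (intro CollectI conjI allI)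
    show "?T v \<in> W" by (intro T_W W_tame vW)
    then show "?T (?T (?T v)) x \<le> ?T v x" for x
      using TT_mono[OF _ uW Tv_le] unfolding v_def by blast
  qed
  then have "u x \<le> ?T v x" for x by (rule u_le)
  with Tv_le have Tv: "u = ?T v" by (intro ext antisym)
  have comp: "b x \<le> a x" if "a \<in> W" "b \<in> W" "a = ?T b" "b = ?T a" for a b x
  proof (rule truncated_compare[OF l W_tame[OF that(1)] W_tame[OF that(2)]])
    show "exp (- pot b x) \<le> a x" if "x \<le> l" for x
      using that by (subst \<open>a = ?T b\<close>) (simp add: cavity_op_def)
    show "b x \<le> exp (- pot a x)" if "x \<le> l" for x
      using that by (subst \<open>b = ?T a\<close>) (simp add: cavity_op_def)
  qed (use that(1,2) in \<open>auto simp: W_def\<close>)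
  have "u = v"
    using comp[OF uW vW Tv v_def] comp[OF vW uW v_def Tv] by (intro ext antisym)
  then have "u = ?T u" using v_def by argo
  then show ?thesis
    unfolding solves_def using W_tame[OF uW] by (intro exI conjI)
qed

text \<open>By monotonicity of \<open>pot\<close>, the minimum and maximum of two solutions satisfy
  the hypotheses of \<open>truncated_compare\<close>, which bounds the maximum by the
  minimum.\<close>

lemma truncated_unique:
  assumes l: "l > 0" and f: "solves {..l} f" and g: "solves {..l} g"
  shows "f = g"
proof -
  note t = solvesD(1)[OF f] solvesD(1)[OF g]
  note fT = solvesD(2)[OF f] and gT = solvesD(2)[OF g]
  note [measurable] = tameD(1)[OF t(1)] tameD(1)[OF t(2)]
  have 0: "f x = 0" "g x = 0" if "x > l" for x
    using that by (subst fT gT, simp)+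
  let ?u = "\<lambda>x. min (f x) (g x)" and ?v = "\<lambda>x. max (f x) (g x)"
  have uv: "tame ?u" "tame ?v"
    using 0 tameD(2,3)[OF t(1)] tameD(2,3)[OF t(2)]
    by (auto intro!: tameI_support[of _ l] min.coboundedI1 max.coboundedI1)
  have "?v x \<le> ?u x" for x
  proof (rule truncated_compare[OF l uv])
    fix x assume "x \<le> l"
    then have x: "f x = exp (- pot f x)" "g x = exp (- pot g x)"
      by (subst fT gT, simp)+
    show "exp (- pot ?v x) \<le> ?u x"
      unfolding x using pot_mono_fun[OF uv(2) t(1), of x] pot_mono_fun[OF uv(2) t(2), of x] by auto
    show "?v x \<le> exp (- pot ?u x)"
      unfolding x using pot_mono_fun[OF t(1) uv(1), of x] pot_mono_fun[OF t(2) uv(1), of x] by auto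
  qed (use 0 in auto)
  then have "f x = g x" for x by (meson antisym max.bounded_iff min.bounded_iff)
  then show ?thesis by blast
qed

text \<open>The exponent \<open>b\<close> at the origin controls itself: it gives a lower bound on
  the growth of the exponent, hence decay of \<open>f\<close>, and this decay bounds
  \<open>b\<close>. The constants do not depend on \<open>A\<close>, so they are uniform in the
  truncation length.\<close>

lemma solves_tail:
  assumes f: "solves A f" and A: "\<And>x y. x \<le> y \<Longrightarrow> y \<in> A \<Longrightarrow> x \<in> A" "0 \<in> A"
  shows "x \<ge> 0 \<Longrightarrow> f x \<le> exp (- (exp (- 1) * x powr d))"
    and "x \<le> 0 \<Longrightarrow> pot f x \<le> exp 1 * exp (- (exp (- 1) * \<bar>x\<bar> powr d))"
proof -
  note t = solvesD(1)[OF f]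
  note [measurable] = tameD(1)[OF t]
  define b where "b = pot f 0"
  have b0: "b \<ge> 0" using pot_nonneg[OF t] by (simp add: b_def)
  have f0: "f 0 = exp (- b)" using A by (subst solvesD(2)[OF f]) (simp add: b_def)
  have anti: "antimono f" by (rule solves_antimono[OF f A(1)])
  have pot_ge: "b + f 0 * x powr d \<le> pot f x" if "x \<ge> 0" for x
  proof -
    \<comment> \<open>For \<open>y > 0\<close> the kernel only grows with \<open>x\<close>, which
      contributes \<open>b\<close>; on \<open>{-x..0}\<close> monotonicity gives
      \<open>f y \<ge> f 0\<close>, which contributes \<open>f 0 * x powr d\<close>.\<close>
    have h: "has_bochner_integral lborel
        (\<lambda>y. kern (0 + y) * f y + f 0 * (kern (x + y) * indicator {-x..0} y)) (b + f 0 * x powr d)"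
      using kern_integral[of "- x" 0 x] that tameD(4)[OF t, of 0]
      by (intro has_bochner_integral_add has_bochner_integral_mult_right)
         (auto simp: has_bochner_integral_iff b_def pot_def)
    have "b + f 0 * x powr d = (\<integral>y. kern (0 + y) * f y + f 0 * (kern (x + y) * indicator {-x..0} y) \<partial>lborel)"
      using h by (simp add: has_bochner_integral_iff)
    also have "\<dots> \<le> pot f x"
      unfolding pot_def
    proof (rule integral_mono)
      fix y
      show "kern (0 + y) * f y + f 0 * (kern (x + y) * indicator {-x..0} y) \<le> kern (x + y) * f y"
      proof (cases "y \<in> {-x..0}")
        case True
        then show ?thesis using antimonoD[OF anti, of y 0]
          by (auto simp: mult.commute intro: mult_right_mono)
      next
        case False
        have "kern y \<le> kern (x + y)" using that by (intro kern_mono) auto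
        then show ?thesis using False tameD(2)[OF t] by (auto intro: mult_right_mono)
      qed
    qed (use h tameD(4)[OF t] in \<open>auto simp: has_bochner_integral_iff\<close>)
    finally show ?thesis .
  qed
  have f_le: "f x \<le> exp (- (b + f 0 * x powr d))" if "x \<ge> 0" for x
    using pot_ge[OF that] by (subst solvesD(2)[OF f]) (auto simp: indicator_def)
  \<comment> \<open>The decay bound is integrated against the kernel at 0. Since
    \<open>f 0 = exp (- b)\<close>, the right-hand side is exactly 1.\<close>
  have "b \<le> exp (- b) * (1 / f 0)"
  proof -
    have h: "has_bochner_integral lborel (\<lambda>y. exp (- b) *
       (indicator {0..} y * (kern y * exp (- f 0 * max 0 y powr d)))) (exp (- b) * (1 / f 0))"
      using tail_integral[of "f 0" 0] f0 by (intro has_bochner_integral_mult_right) auto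
    have "b \<le> (\<integral>y. exp (- b) * (indicator {0..} y * (kern y * exp (- f 0 * max 0 y powr d))) \<partial>lborel)"
      unfolding b_def pot_def[of f]
    proof (rule integral_mono, goal_cases)
      case (3 y)
      show ?case
      proof (cases "y \<ge> 0")
        case True
        then have "f y \<le> exp (- b) * exp (- f 0 * max 0 y powr d)"
          using f_le[OF True] by (simp add: exp_add[symmetric])
        from mult_left_mono[OF this, of "kern y"] True show ?thesis
          by (simp add: mult_ac b_def pot_def)
      qed auto
    qed (use h tameD(4)[OF t, of 0] in \<open>auto simp: has_bochner_integral_iff b_def pot_def\<close>)
    then show ?thesis using h by (simp add: has_bochner_integral_iff)
  qed
  then have b1: "b \<le> 1" by (simp add: f0)
  show tail: "f x \<le> exp (- (exp (- 1) * x powr d))" if "x \<ge> 0" for x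
  proof -
    have "f x \<le> exp (- (b + f 0 * x powr d))" by (rule f_le[OF that])
    also have "\<dots> \<le> exp (- (exp (- 1) * x powr d))"
      using b0 mult_right_mono[of "exp (- 1)" "f 0" "x powr d"] b1 by (simp add: f0)
    finally show ?thesis .
  qed
  show "pot f x \<le> exp 1 * exp (- (exp (- 1) * \<bar>x\<bar> powr d))" if "x \<le> 0"
  proof -
    \<comment> \<open>Since \<open>x \<le> 0\<close>, the kernel at \<open>x\<close> is at most the
      one at 0 and sees only \<open>y \<ge> -x \<ge> 0\<close>, where the decay bound
      applies.\<close>
    have h: "has_bochner_integral lborel
       (\<lambda>y. indicator {-x..} y * (kern y * exp (- exp (- 1) * max 0 y powr d)))
       (exp (- exp (- 1) * max 0 (- x) powr d) / exp (- 1))"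
      by (rule tail_integral) auto
    have "pot f x \<le> (\<integral>y. indicator {-x..} y * (kern y * exp (- exp (- 1) * max 0 y powr d)) \<partial>lborel)"
      unfolding pot_def
    proof (rule integral_mono, goal_cases)
      case (3 y)
      show ?case
      proof (cases "y \<ge> - x")
        case True
        then show ?thesis
          using that tail[of y] kern_mono[of "x + y" y] tameD(2)[OF t, of y]
          by (auto intro!: mult_mono)
      qed auto
    qed (use h tameD(4)[OF t] in \<open>auto simp: has_bochner_integral_iff\<close>)
    also have "\<dots> = exp 1 * exp (- (exp (- 1) * \<bar>x\<bar> powr d))"
      using h that by (simp add: has_bochner_integral_iff exp_minus divide_simps)
    finally show ?thesis .
  qed
qed

end

context pseudo_dimension
begin

subsection \<open>Uniqueness on the whole line\<close>

text \<open>The growth of the kernel in \<open>y\<close>, up to a factor depending on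
  \<open>x\<close>. The lower cut-off at 1 lets weighted integrability imply plain
  integrability.\<close>

definition weight :: "real \<Rightarrow> real" where
  "weight y = max 1 \<bar>y\<bar> powr (d - 1)"

lemma weight_ge_1: "1 \<le> weight y"
  unfolding weight_def using d_gt_1 by (intro ge_one_powr_ge_zero) auto

lemma weight_measurable [measurable]: "weight \<in> borel_measurable borel"
  unfolding weight_def by measurable

text \<open>On [-1, 1] the weight is 1; outside it is at most \<open>kern \<bar>y\<bar>\<close>, so
  the integrand of \<open>tail_integral\<close> and its reflection supply a majorant.\<close>

lemma weight_exp_integrable:
  assumes c: "c > 0"
  shows "integrable lborel (\<lambda>y. weight y * exp (- (c * \<bar>y\<bar> powr d)))"
proof (rule Bochner_Integration.integrable_bound)
  let ?h = "\<lambda>y. indicator {0..} y * (kern y * exp (- c * max 0 y powr d))"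
  have h: "integrable lborel ?h"
    using tail_integral[OF c, of 0] by (simp add: has_bochner_integral_iff)
  have "integrable lborel (\<lambda>y. ?h (0 + (- 1) * y))"
    using lborel_integrable_real_affine[OF h, of "-1" 0] by simp
  with h show "integrable lborel (\<lambda>y. indicator {-1..1} y + (?h y + ?h (0 + (- 1) * y)))"
    by (intro Bochner_Integration.integrable_add) auto
  show "AE y in lborel. norm (weight y * exp (- (c * \<bar>y\<bar> powr d)))
      \<le> norm (indicator {-1..1} y + (?h y + ?h (0 + (- 1) * y)))"
  proof (intro AE_I2)
    fix y :: real
    have nn: "0 \<le> ?h z" for z by auto
    have "weight y * exp (- (c * \<bar>y\<bar> powr d)) \<le> indicator {-1..1} y + (?h y + ?h (- y))"
    proof (cases "\<bar>y\<bar> \<le> 1")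
      case True
      have "weight y * exp (- (c * \<bar>y\<bar> powr d)) \<le> 1 * 1"
        using True c by (intro mult_mono) (auto simp: weight_def max_def)
      moreover have "indicator {-1..1} y = (1::real)" using True by (auto simp: abs_le_iff)
      ultimately show ?thesis using nn[of y] nn[of "- y"] by linarith
    next
      case False
      have k: "weight y \<le> kern \<bar>y\<bar>"
        using False d_gt_1 mult_right_mono[of 1 d "\<bar>y\<bar> powr (d - 1)"]
        by (auto simp: weight_def kern_def max_def)
      have "weight y * exp (- (c * \<bar>y\<bar> powr d)) \<le> ?h \<bar>y\<bar>"
        using mult_right_mono[OF k, of "exp (- (c * \<bar>y\<bar> powr d))"] by simp
      also have "\<dots> \<le> indicator {-1..1} y + (?h y + ?h (- y))"
        using nn[of y] nn[of "- y"] by (cases "y \<ge> 0") auto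
      finally show ?thesis .
    qed
    moreover have "0 \<le> weight y" using weight_ge_1[of y] by linarith
    ultimately show "norm (weight y * exp (- (c * \<bar>y\<bar> powr d)))
      \<le> norm (indicator {-1..1} y + (?h y + ?h (0 + (- 1) * y)))"
      by (simp add: abs_mult)
  qed
qed simp

lemma weight_integrable_imp:
  assumes [measurable]: "\<phi> \<in> borel_measurable borel"
    and "integrable lborel (\<lambda>y. weight y * \<phi> y)"
  shows "integrable lborel \<phi>"
proof (rule Bochner_Integration.integrable_bound[OF assms(2)])
  show "AE y in lborel. norm (\<phi> y) \<le> norm (weight y * \<phi> y)"
  proof (intro AE_I2)
    fix y
    show "norm (\<phi> y) \<le> norm (weight y * \<phi> y)"
      using weight_ge_1[of y] mult_right_mono[OF weight_ge_1, of "\<bar>\<phi> y\<bar>" y] by (simp add: abs_mult)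
  qed
qed simp

text \<open>Translation changes the weight at most by the factor
  \<open>(1 + \<bar>t\<bar>) powr (d - 1)\<close>.\<close>

lemma weight_integrable_shift:
  assumes [measurable]: "\<phi> \<in> borel_measurable borel"
    and i: "integrable lborel (\<lambda>y. weight y * \<phi> y)"
  shows "integrable lborel (\<lambda>y. weight y * \<phi> (y - t))"
proof (rule Bochner_Integration.integrable_bound)
  have "integrable lborel (\<lambda>y. weight (- t + 1 * y) * \<phi> (- t + 1 * y))"
    by (rule lborel_integrable_real_affine[OF i]) simp
  then show "integrable lborel (\<lambda>y. (1 + \<bar>t\<bar>) powr (d - 1) * (weight (y - t) * \<phi> (y - t)))"
    by (intro Bochner_Integration.integrable_mult_right) (simp add: algebra_simps)
  show "AE y in lborel. norm (weight y * \<phi> (y - t)) \<le>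
      norm ((1 + \<bar>t\<bar>) powr (d - 1) * (weight (y - t) * \<phi> (y - t)))"
  proof (intro AE_I2)
    fix y
    have "max 1 \<bar>y\<bar> \<le> max 1 \<bar>y - t\<bar> + \<bar>t\<bar> * 1" by auto
    also have "\<dots> \<le> max 1 \<bar>y - t\<bar> + \<bar>t\<bar> * max 1 \<bar>y - t\<bar>" by (intro add_left_mono mult_left_mono) auto
    finally have "max 1 \<bar>y\<bar> \<le> (1 + \<bar>t\<bar>) * max 1 \<bar>y - t\<bar>" by (simp add: algebra_simps)
    then have "weight y \<le> (1 + \<bar>t\<bar>) powr (d - 1) * weight (y - t)"
      unfolding weight_def using d_gt_1
      by (subst powr_mult[symmetric]) (auto intro!: powr_mono2)
    from mult_right_mono[OF this, of "\<bar>\<phi> (y - t)\<bar>"] weight_ge_1[of y] weight_ge_1[of "y - t"]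
    show "norm (weight y * \<phi> (y - t)) \<le>
      norm ((1 + \<bar>t\<bar>) powr (d - 1) * (weight (y - t) * \<phi> (y - t)))"
      by (simp add: abs_mult mult.assoc)
  qed
qed simp

text \<open>For \<open>x > 0\<close>, dividing \<open>kern (x + y)\<close> by
  \<open>d * x powr (d - 1)\<close> leaves the power in the integrand. It tends to 1 and, for
  \<open>x \<ge> 1\<close>, is at most \<open>2 powr (d - 1) * weight y\<close>.\<close>

lemma weighted_limit:
  assumes [measurable]: "\<phi> \<in> borel_measurable borel"
    and i: "integrable lborel (\<lambda>y. weight y * \<phi> y)"
  shows "((\<lambda>x. \<integral>y. max 0 (1 + y / x) powr (d - 1) * \<phi> y \<partial>lborel) \<longlongrightarrow> (\<integral>y. \<phi> y \<partial>lborel)) at_top"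
proof (rule integral_dominated_convergence_at_top)
  show "integrable lborel (\<lambda>y. 2 powr (d - 1) * norm (weight y * \<phi> y))"
    using i by (intro Bochner_Integration.integrable_mult_right integrable_norm)
  show "AE y in lborel. ((\<lambda>x. max 0 (1 + y / x) powr (d - 1) * \<phi> y) \<longlongrightarrow> \<phi> y) at_top"
  proof (intro AE_I2)
    fix y :: real
    have "((\<lambda>x. y / x) \<longlongrightarrow> 0) at_top"
      by (intro tendsto_divide_0[OF tendsto_const] filterlim_at_top_imp_at_infinity filterlim_ident)
    then have "((\<lambda>x. max 0 (1 + y / x) powr (d - 1) * \<phi> y) \<longlongrightarrow> max 0 (1 + 0) powr (d - 1) * \<phi> y) at_top"
      by (intro tendsto_intros) auto
    then show "((\<lambda>x. max 0 (1 + y / x) powr (d - 1) * \<phi> y) \<longlongrightarrow> \<phi> y) at_top" by simp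
  qed
  show "\<forall>\<^sub>F x in at_top. AE y in lborel.
      norm (max 0 (1 + y / x) powr (d - 1) * \<phi> y) \<le> 2 powr (d - 1) * norm (weight y * \<phi> y)"
    using eventually_ge_at_top[of 1]
  proof (eventually_elim, intro AE_I2)
    fix x y :: real assume x: "1 \<le> x"
    have "y / x \<le> \<bar>y\<bar> / x" using x by (intro divide_right_mono) auto
    also have "\<dots> \<le> \<bar>y\<bar>" using x divide_left_mono[of 1 x "\<bar>y\<bar>"] by simp
    finally have "max 0 (1 + y / x) \<le> 2 * max 1 \<bar>y\<bar>" by auto
    then have "max 0 (1 + y / x) powr (d - 1) \<le> 2 powr (d - 1) * weight y"
      unfolding weight_def using d_gt_1
      by (subst powr_mult[symmetric]) (auto intro!: powr_mono2)
    from mult_right_mono[OF this, of "\<bar>\<phi> y\<bar>"] weight_ge_1[of y]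
    show "norm (max 0 (1 + y / x) powr (d - 1) * \<phi> y) \<le> 2 powr (d - 1) * norm (weight y * \<phi> y)"
      by (simp add: abs_mult mult.assoc)
  qed
qed auto

section \<open>Integrals renormalised by a step function\<close>

definition dev :: "(real \<Rightarrow> real) \<Rightarrow> real \<Rightarrow> real" where
  "dev f y = f y - indicator {..<0} y"

text \<open>A solution tends to 1 at minus infinity and is not integrable; subtracting the step
  function repairs this. The result is the \<open>s f\<close> of the overview and measures the
  position of the profile.\<close>

definition mass :: "(real \<Rightarrow> real) \<Rightarrow> real" where
  "mass f = (\<integral>y. dev f y \<partial>lborel)"

lemma solves_UNIV_D:
  assumes "solves UNIV f"
  shows "tame f" "f x = exp (- pot f x)"
  using solvesD(1)[OF assms] solvesD(2)[OF assms, of x] by auto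

lemma dev_measurable:
  "f \<in> borel_measurable borel \<Longrightarrow> dev f \<in> borel_measurable borel"
  unfolding dev_def[abs_def] by (intro borel_measurable_diff borel_measurable_indicator) auto

text \<open>On the right this is the decay of \<open>f\<close>; on the left, 1 - exp (-p) \<le> p
  reduces it to the bound on the potential.\<close>

lemma dev_bound:
  assumes f: "solves UNIV f"
  shows "\<bar>dev f y\<bar> \<le> exp 1 * exp (- (exp (- 1) * \<bar>y\<bar> powr d))"
proof (cases "y \<ge> 0")
  case True
  then have "\<bar>dev f y\<bar> \<le> exp (- (exp (- 1) * \<bar>y\<bar> powr d))"
    using solves_tail(1)[OF f _ _ True] tameD(2)[OF solves_UNIV_D(1)[OF f], of y]
    by (simp add: dev_def)
  also have "\<dots> \<le> exp 1 * exp (- (exp (- 1) * \<bar>y\<bar> powr d))" by simp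
  finally show ?thesis .
next
  case False
  have "1 - f y \<le> pot f y"
    using exp_ge_add_one_self[of "- pot f y"] by (subst solves_UNIV_D(2)[OF f]) simp
  then show ?thesis
    using False solves_tail(2)[OF f, of y] tameD(3)[OF solves_UNIV_D(1)[OF f], of y]
    by (simp add: dev_def)
qed

lemma dev_integrable:
  assumes f: "solves UNIV f"
  shows "integrable lborel (\<lambda>y. weight y * dev f y)" "integrable lborel (dev f)"
proof -
  note [measurable] = dev_measurable[OF tameD(1)[OF solves_UNIV_D(1)[OF f]]]
  show i: "integrable lborel (\<lambda>y. weight y * dev f y)"
  proof (rule Bochner_Integration.integrable_bound)
    show "integrable lborel (\<lambda>y. exp 1 * (weight y * exp (- (exp (- 1) * \<bar>y\<bar> powr d))))"
      by (intro Bochner_Integration.integrable_mult_right weight_exp_integrable) simp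
    show "AE y in lborel. norm (weight y * dev f y) \<le>
        norm (exp 1 * (weight y * exp (- (exp (- 1) * \<bar>y\<bar> powr d))))"
    proof (intro AE_I2)
      fix y
      show "norm (weight y * dev f y) \<le> norm (exp 1 * (weight y * exp (- (exp (- 1) * \<bar>y\<bar> powr d))))"
        using mult_left_mono[OF dev_bound[OF f, of y], of "weight y"] weight_ge_1[of y]
        by (simp add: abs_mult mult_ac)
    qed
  qed simp
  show "integrable lborel (dev f)"
    by (rule weight_integrable_imp[OF _ i]) simp
qed

lemma shift_diff_integral:
  assumes f: "solves UNIV f" and g: "solves UNIV g" and t: "t \<ge> 0"
  shows "integrable lborel (\<lambda>y. weight y * (f (y - t) - g y))"
    and "integrable lborel (\<lambda>y. f (y - t) - g y)"
    and "(\<integral>y. f (y - t) - g y \<partial>lborel) = mass f - mass g + t"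
proof -
  note mf [measurable] = tameD(1)[OF solves_UNIV_D(1)[OF f]]
  note mg [measurable] = tameD(1)[OF solves_UNIV_D(1)[OF g]]
  note [measurable] = dev_measurable[OF mf] dev_measurable[OF mg]
  \<comment> \<open>Translating the step function by \<open>t \<ge> 0\<close> adds exactly the
    interval \<open>{0..<t}\<close>, whose length is the summand \<open>t\<close>.\<close>
  have eq: "f (y - t) - g y = dev f (y - t) - dev g y + indicator {0..<t} y" for y
    using t by (auto simp: dev_def indicator_def)
  have "integrable lborel (\<lambda>y. weight y * indicator {0..<t} y)"
  proof (rule Bochner_Integration.integrable_bound)
    show "integrable lborel (\<lambda>y. weight t * indicator {0..<t} y)"
      by (intro Bochner_Integration.integrable_mult_right) (simp add: t)
    show "AE y in lborel. norm (weight y * indicator {0..<t} y) \<le> norm (weight t * indicator {0..<t} y)"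
      using d_gt_1 by (intro AE_I2) (auto simp: weight_def indicator_def intro!: powr_mono2)
  qed simp
  then show i: "integrable lborel (\<lambda>y. weight y * (f (y - t) - g y))"
    using weight_integrable_shift[OF _ dev_integrable(1)[OF f], of t] dev_integrable(1)[OF g]
    unfolding eq by (simp add: ring_distribs)
  show "integrable lborel (\<lambda>y. f (y - t) - g y)"
    by (rule weight_integrable_imp[OF _ i]) simp
  have s: "integrable lborel (\<lambda>y. dev f (y - t))" "(\<integral>y. dev f (y - t) \<partial>lborel) = mass f"
    using lborel_integrable_real_affine[OF dev_integrable(2)[OF f], of 1 "- t"]
      lborel_integral_real_affine[of 1 "dev f" "- t"] by (auto simp: mass_def)
  then show "(\<integral>y. f (y - t) - g y \<partial>lborel) = mass f - mass g + t"
    unfolding eq using dev_integrable(2)[OF g] t by (simp add: mass_def)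
qed

text \<open>The difference of the exponents factors as \<open>d * x powr (d - 1)\<close> times an
  integral that tends to the positive number \<open>mass f - mass g + t\<close>.\<close>

lemma eventually_pot_less_shift:
  assumes f: "solves UNIV f" and g: "solves UNIV g" and t: "t \<ge> 0" and "mass f - mass g + t > 0"
  shows "\<forall>\<^sub>F x in at_top. pot g x < pot f (x + t)"
proof -
  note tf = solves_UNIV_D(1)[OF f] and tg = solves_UNIV_D(1)[OF g]
  note [measurable] = tameD(1)[OF tf] tameD(1)[OF tg]
  have "((\<lambda>x. \<integral>y. max 0 (1 + y / x) powr (d - 1) * (f (y - t) - g y) \<partial>lborel) \<longlongrightarrow> mass f - mass g + t) at_top"
    using weighted_limit[OF _ shift_diff_integral(1)[OF f g t]] shift_diff_integral(3)[OF f g t] by simp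
  from order_tendstoD(1)[OF this assms(4)] eventually_gt_at_top[of 0]
  show ?thesis
  proof eventually_elim
    case (elim x)
    have k: "kern (x + y) = d * x powr (d - 1) * max 0 (1 + y / x) powr (d - 1)" for y
    proof -
      have "max 0 (x + y) = x * max 0 (1 + y / x)"
      proof -
        have "x * (1 + y / x) = x + y" using elim(2) by (simp add: field_simps)
        then show ?thesis using elim(2) by (simp add: max_mult_distrib_left)
      qed
      then show ?thesis using elim(2) by (simp add: kern_def powr_mult)
    qed
    have "pot f (x + t) - pot g x = (\<integral>y. kern (x + y) * f (y - t) - kern (x + y) * g y \<partial>lborel)"
      unfolding pot_shift(2)[OF tf] unfolding pot_def
      by (rule Bochner_Integration.integral_diff[symmetric]) (rule pot_shift(1)[OF tf] tameD(4)[OF tg])+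
    also have "\<dots> = d * x powr (d - 1) * (\<integral>y. max 0 (1 + y / x) powr (d - 1) * (f (y - t) - g y) \<partial>lborel)"
      by (subst integral_mult_right_zero[symmetric]) (simp only: k right_diff_distrib mult.assoc)
    also have "\<dots> > 0" using elim d_gt_1 by (intro mult_pos_pos) auto
    finally show ?case by simp
  qed
qed

text \<open>Integrating the non-negative \<open>f (y - t) - g y\<close> gives the weak inequality.
  Equality would make this difference vanish almost everywhere, so the exponents agree and the
  equation yields \<open>f (x + t) = g x\<close>; integrating that relation gives
  \<open>2 * t = 0\<close>.\<close>

lemma mass_less_of_shift:
  assumes f: "solves UNIV f" and g: "solves UNIV g" and t: "t > 0"
    and le: "\<And>x. g (x + t) \<le> f x"
  shows "mass g < mass f + t"
proof (rule ccontr)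
  assume neg: "\<not> mass g < mass f + t"
  have t': "t \<ge> 0" using t by simp
  note i = shift_diff_integral[OF f g t']
  have nn: "0 \<le> f (y - t) - g y" for y using le[of "y - t"] by simp
  have "(\<integral>y. f (y - t) - g y \<partial>lborel) \<ge> 0" using nn by simp
  with i(3) neg have eq: "mass g = mass f + t" by simp
  have "AE y in lborel. f (y - t) - g y = 0"
    using i(3) eq nn by (subst integral_nonneg_eq_0_iff_AE[OF i(2), symmetric]) auto
  note tf = solves_UNIV_D(1)[OF f] and tg = solves_UNIV_D(1)[OF g]
  note [measurable] = tameD(1)[OF tf] tameD(1)[OF tg]
  have "pot f (x + t) = pot g x" for x
    unfolding pot_shift(2)[OF tf] unfolding pot_def
  proof (rule integral_cong_AE)
    show "AE y in lborel. kern (x + y) * f (y - t) = kern (x + y) * g y"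
      using \<open>AE y in lborel. f (y - t) - g y = 0\<close> by eventually_elim simp
  qed auto
  then have "f (x + t) = g x" for x
    by (subst solves_UNIV_D(2)[OF f], subst solves_UNIV_D(2)[OF g]) simp
  from this[of "y - t" for y] have "f y = g (y - t)" for y by simp
  then have "(\<integral>y. g (y - t) - f y \<partial>lborel) = 0" by simp
  with shift_diff_integral(3)[OF g f t'] eq t show False by simp
qed

text \<open>
  Each of the two inequalities controls the other one near the opposite end of the line, so both
  are compared at once.
\<close>

definition shifts :: "(real \<Rightarrow> real) \<Rightarrow> (real \<Rightarrow> real) \<Rightarrow> real set" where
  "shifts f g = {t. \<forall>x\<in>UNIV. pot g x \<le> pot f (x + t)} \<inter> {t. \<forall>x\<in>UNIV. pot f x \<le> pot g (x + t)} \<inter> {0..}"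

lemma shiftsD:
  assumes f: "solves UNIV f" and g: "solves UNIV g" and "t \<in> shifts f g"
  shows "f (x + t) \<le> g x" "g (x + t) \<le> f x"
  using assms(3) solves_UNIV_D(2)[OF f, of x] solves_UNIV_D(2)[OF f, of "x + t"]
    solves_UNIV_D(2)[OF g, of x] solves_UNIV_D(2)[OF g, of "x + t"]
  by (auto simp: shifts_def)

text \<open>The asymptotics settle large \<open>x\<close>; the resulting comparison of functions
  settles very negative \<open>x\<close>, where the potential sees only large \<open>y\<close>.
  Monotonicity of \<open>pot\<close> makes one \<open>X\<close> serve all \<open>t \<ge> r\<close>,
  so a shift can later be lowered towards \<open>r\<close>.\<close>

lemma shift_outside_compact:
  assumes f: "solves UNIV f" and g: "solves UNIV g" and r: "r > \<bar>mass f - mass g\<bar>"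
  shows "\<exists>X\<ge>0. \<forall>t\<ge>r. (\<forall>x. \<bar>x\<bar> \<ge> X \<longrightarrow> pot g x \<le> pot f (x + t) \<and> pot f x \<le> pot g (x + t)) \<and>
    (\<forall>x\<ge>X. f (x + t) < g x \<and> g (x + t) < f x)"
proof -
  note tf = solves_UNIV_D(1)[OF f] and tg = solves_UNIV_D(1)[OF g]
  have "\<forall>\<^sub>F x in at_top. pot g x < pot f (x + r) \<and> pot f x < pot g (x + r)"
    using eventually_pot_less_shift[OF f g, of r] eventually_pot_less_shift[OF g f, of r] r
    by (intro eventually_conj) auto
  then obtain X0 where "\<And>x. x \<ge> X0 \<Longrightarrow> pot g x < pot f (x + r) \<and> pot f x < pot g (x + r)"
    by (auto simp: eventually_at_top_linorder)
  then have X0: "pot g x < pot f (x + t)" "pot f x < pot g (x + t)" if "x \<ge> X0" "t \<ge> r" for x t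
    using that pot_mono[OF tf, of "x + r" "x + t"] pot_mono[OF tg, of "x + r" "x + t"] by force+
  have st: "f (x + t) < g x" "g (x + t) < f x" if "x \<ge> X0" "t \<ge> r" for x t
    using X0[OF that] solves_UNIV_D(2)[OF f, of x] solves_UNIV_D(2)[OF f, of "x + t"]
    solves_UNIV_D(2)[OF g, of x] solves_UNIV_D(2)[OF g, of "x + t"] by auto
  have left: "pot g x \<le> pot f (x + t)" "pot f x \<le> pot g (x + t)" if "x \<le> - (\<bar>X0\<bar> + r)" "t \<ge> r" for x t
  proof -
    have "f y \<le> g (y - r)" "g y \<le> f (y - r)" if "y \<ge> - x" for y
    proof -
      have "X0 \<le> y - r" using that \<open>x \<le> - (\<bar>X0\<bar> + r)\<close> by linarith
      from st[OF this order_refl] show "f y \<le> g (y - r)" "g y \<le> f (y - r)" by auto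
    qed
    then have "pot g x \<le> pot f (x + r)" "pot f x \<le> pot g (x + r)"
      by (auto intro!: pot_le_shift tf tg)
    then show "pot g x \<le> pot f (x + t)" "pot f x \<le> pot g (x + t)"
      using that pot_mono[OF tf, of "x + r" "x + t"] pot_mono[OF tg, of "x + r" "x + t"] by force+
  qed
  show ?thesis
  proof (intro exI[of _ "\<bar>X0\<bar> + r"] conjI allI impI)
    fix t x assume t: "r \<le> t"
    show "pot g x \<le> pot f (x + t)" "pot f x \<le> pot g (x + t)" if "\<bar>x\<bar> \<ge> \<bar>X0\<bar> + r"
      using left[of x t] X0[of x t] that t r by force+
    show "f (x + t) < g x" "g (x + t) < f x" if "x \<ge> \<bar>X0\<bar> + r"
      using st[of x t] that t r by force+
  qed (use r in auto)
qed

text \<open>The part of the integral over \<open>{-x..0}\<close>, where \<open>f \<ge> f 0\<close>,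
  already grows like \<open>x powr d\<close>. This provides a first admissible shift on bounded
  ranges of \<open>x\<close>.\<close>

lemma pot_at_top:
  assumes f: "solves UNIV f"
  shows "\<exists>x. c \<le> pot f x"
proof -
  note tf = solves_UNIV_D(1)[OF f]
  have anti: "antimono f" by (rule solves_antimono[OF f]) auto
  have f0: "f 0 > 0" by (subst solves_UNIV_D(2)[OF f]) simp
  define x where "x = max 1 (\<bar>c\<bar> / f 0)"
  have "\<bar>c\<bar> / f 0 \<le> x" by (simp add: x_def)
  then have "c \<le> f 0 * x" using f0 by (simp add: pos_divide_le_eq mult.commute)
  also have "\<dots> \<le> f 0 * x powr d"
    using f0 d_gt_1 powr_mono[of 1 d x] by (intro mult_left_mono) (auto simp: x_def)
  also have "\<dots> = (\<integral>y. f 0 * (kern (x + y) * indicator {-x..0} y) \<partial>lborel)"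
    using kern_integral[of "- x" 0 x] by (simp add: has_bochner_integral_iff x_def)
  also have "\<dots> \<le> pot f x"
    unfolding pot_def
  proof (rule integral_mono)
    show "integrable lborel (\<lambda>y. f 0 * (kern (x + y) * indicator {-x..0} y))"
      using kern_integral[of "- x" 0 x]
      by (intro Bochner_Integration.integrable_mult_right) (simp add: has_bochner_integral_iff x_def)
    show "f 0 * (kern (x + y) * indicator {-x..0} y) \<le> kern (x + y) * f y" for y
      using antimonoD[OF anti, of y 0] tameD(2)[OF tf, of y]
      by (cases "y \<in> {-x..0}") (auto simp: mult.commute intro: mult_right_mono)
  qed (rule tameD(4)[OF tf])
  finally show ?thesis by blast
qed

lemma solution_unique:
  assumes f: "solves UNIV f" and g: "solves UNIV g"
  shows "f = g"
proof -
  note tf = solves_UNIV_D(1)[OF f] and tg = solves_UNIV_D(1)[OF g]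
  have "0 \<in> shifts f g"
  proof (rule closed_shift_set_contains_0)
    show "closed (shifts f g)"
      unfolding shifts_def by (intro closed_Int closed_pot_shift tf tg) auto
    show "shifts f g \<subseteq> {0..}" by (auto simp: shifts_def)
    show "shifts f g \<noteq> {}"
    proof -
      define r where "r = \<bar>mass f - mass g\<bar> + 1"
      obtain X where X: "X \<ge> 0" "\<And>t x. t \<ge> r \<Longrightarrow> \<bar>x\<bar> \<ge> X \<Longrightarrow> pot g x \<le> pot f (x + t) \<and> pot f x \<le> pot g (x + t)"
        using shift_outside_compact[OF f g, of r] by (auto simp: r_def)
      \<comment> \<open>In the middle range the potentials at \<open>X\<close> bound the left-hand
        sides, and a shift taking \<open>x\<close> beyond \<open>a\<close> and \<open>b\<close>
        bounds the right-hand sides from below.\<close>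
      obtain a b where ab: "pot g X \<le> pot f a" "pot f X \<le> pot g b"
        using pot_at_top[OF f] pot_at_top[OF g] by blast
      define t where "t = \<bar>a\<bar> + \<bar>b\<bar> + X + r"
      have "pot g x \<le> pot f (x + t) \<and> pot f x \<le> pot g (x + t)" for x
      proof (cases "\<bar>x\<bar> \<ge> X")
        case True
        then show ?thesis using X by (intro X(2)) (auto simp: t_def)
      next
        case False
        then have "x \<le> X" "a \<le> x + t" "b \<le> x + t"
          unfolding t_def r_def by linarith+
        then show ?thesis
          using ab pot_mono[OF tg, of x X] pot_mono[OF tf, of x X]
            pot_mono[OF tf, of a "x + t"] pot_mono[OF tg, of b "x + t"]
          by linarith
      qed
      moreover have "t \<ge> 0" using X by (auto simp: t_def r_def)
      ultimately show ?thesis by (auto simp: shifts_def)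
    qed
    fix t assume t: "t \<in> shifts f g" "t > 0"
    note sh = shiftsD[OF f g t(1)]
    \<comment> \<open>The strict bound leaves room for some \<open>r\<close> below \<open>t\<close>
      that still controls everything outside a compact interval.\<close>
    have "\<bar>mass f - mass g\<bar> < t"
      using mass_less_of_shift[OF f g t(2) sh(2)] mass_less_of_shift[OF g f t(2) sh(1)] by linarith
    then obtain r where r: "\<bar>mass f - mass g\<bar> < r" "r < t" using dense by blast
    from shift_outside_compact[OF f g r(1)] obtain X where X: "X \<ge> 0"
      "\<And>t x. t \<ge> r \<Longrightarrow> \<bar>x\<bar> \<ge> X \<Longrightarrow> pot g x \<le> pot f (x + t) \<and> pot f x \<le> pot g (x + t)"
      "\<And>t x. t \<ge> r \<Longrightarrow> x \<ge> X \<Longrightarrow> f (x + t) < g x \<and> g (x + t) < f x" by blast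
    have less: "pot g x < pot f (x + t)" "pot f x < pot g (x + t)" for x
    proof -
      have le: "g y \<le> f (y - t)" "f y \<le> g (y - t)" for y using sh[of "y - t"] by auto
      have lt: "g y < f (y - t)" "f y < g (y - t)" if "X + t < y" for y
        using X(3)[of t "y - t"] r that by auto
      \<comment> \<open>The chosen interval of length 1 lies to the right of \<open>-x\<close>,
        where the kernel is positive, and of \<open>X + t\<close>, where the comparison is
        strict.\<close>
      show "pot g x < pot f (x + t)" "pot f x < pot g (x + t)"
        using le lt
        by (auto intro!: pot_less_shift[where p = "max (- x) (X + t)" and q = "max (- x) (X + t) + 1"] tf tg)
    qed
    obtain s1 where s1: "r < s1" "s1 < t" "\<And>s x. s \<ge> s1 \<Longrightarrow> x \<in> {-X..X} \<Longrightarrow> pot g x \<le> pot f (x + s)"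
      using pot_shift_smaller[OF tf tg r(2), of "-X" X] less by blast
    obtain s2 where s2: "r < s2" "s2 < t" "\<And>s x. s \<ge> s2 \<Longrightarrow> x \<in> {-X..X} \<Longrightarrow> pot f x \<le> pot g (x + s)"
      using pot_shift_smaller[OF tg tf r(2), of "-X" X] less by blast
    define s where "s = max s1 s2"
    have "pot g x \<le> pot f (x + s) \<and> pot f x \<le> pot g (x + s)" for x
    proof (cases "\<bar>x\<bar> \<ge> X")
      case True
      then show ?thesis using s1 by (intro X(2)) (auto simp: s_def)
    next
      case False
      then have "x \<in> {-X..X}" by auto
      then show ?thesis using s1(3)[of s x] s2(3)[of s x] by (auto simp: s_def)
    qed
    then have "s \<in> shifts f g" using s1 r by (auto simp: shifts_def s_def)
    then show "\<exists>s\<in>shifts f g. s < t" using s1 s2 by (auto simp: s_def intro!: bexI[of _ s])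
  qed
  from shiftsD[OF f g this] show ?thesis by (intro ext antisym) auto
qed

end

lemma exp_neg_antimono: "s \<le> t \<Longrightarrow> exp_neg t \<le> exp_neg s"
  by (auto simp: exp_neg_def top_unique less_top intro!: enn2real_mono)

lemma exp_neg_ennreal: "0 \<le> r \<Longrightarrow> exp_neg (ennreal r) = exp (- r)"
  by (simp add: exp_neg_def)

context pseudo_dimension
begin

subsection \<open>Comparison with the definitions\<close>

text \<open>Extended-valued, so that it is meaningful before the exponent is known to be
  finite.\<close>

definition nnpot :: "(real \<Rightarrow> real) \<Rightarrow> real \<Rightarrow> ennreal" where
  "nnpot w x = (\<integral>\<^sup>+y. ennreal (kern (x + y) * w y) \<partial>lebesgue)"

lemma nnpot_mono: "(\<And>y. 0 \<le> w y) \<Longrightarrow> x \<le> x' \<Longrightarrow> nnpot w x \<le> nnpot w x'"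
  unfolding nnpot_def by (intro nn_integral_mono ennreal_leI mult_right_mono kern_mono) auto

lemma exp_neg_nnpot:
  assumes "tame w"
  shows "exp_neg (nnpot w x) = exp (- pot w x)"
proof -
  have "nnpot w x = ennreal (pot w x)"
    unfolding nnpot_def pot_def nn_integral_completion
    by (intro nn_integral_eq_integral tameD[OF assms]) (use tameD[OF assms] in auto)
  then show ?thesis using pot_nonneg[OF assms] by (simp add: exp_neg_ennreal)
qed

lemma nnpot_atLeast:
  "(\<integral>\<^sup>+y\<in>{-x..}. ennreal (d * (x + y) powr (d - 1) * w y) \<partial>lebesgue) = nnpot w x"
  unfolding nnpot_def
proof (rule nn_integral_cong)
  fix y
  show "ennreal (d * (x + y) powr (d - 1) * w y) * indicator {-x..} y = ennreal (kern (x + y) * w y)"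
    by (cases "y \<ge> - x") (auto simp: kern_def)
qed

definition extend :: "real \<Rightarrow> (real \<Rightarrow> real) \<Rightarrow> real \<Rightarrow> real" where
  "extend l g x = (if x < - l then 1 else if x \<le> l then g x else 0)"

text \<open>For \<open>x\<close> in the interval, \<open>-x \<ge> -l\<close>, so the extension takes
  its added values 1 only where the kernel vanishes.\<close>

lemma nnpot_extend:
  assumes "x \<in> {-l..l}"
  shows "(\<integral>\<^sup>+y\<in>{-x..l}. ennreal (d * (x + y) powr (d - 1) * g y) \<partial>lebesgue) = nnpot (extend l g) x"
  unfolding nnpot_def
proof (rule nn_integral_cong)
  fix y
  show "ennreal (d * (x + y) powr (d - 1) * g y) * indicator {-x..l} y = ennreal (kern (x + y) * extend l g y)"
    using assms by (cases "y \<ge> - x"; cases "y \<le> l") (auto simp: kern_def extend_def)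
qed

text \<open>Monotonicity of the extended-valued exponent comes first: it makes the extension
  non-increasing, hence Borel measurable and, with support bounded on the right,
  \<open>tame\<close>. Then \<open>pot\<close> may replace \<open>nnpot\<close>.\<close>

lemma solves_extend:
  assumes g: "truncated_solution d l g" and l: "l > 0"
  shows "solves {..l} (extend l g)"
proof -
  let ?f = "extend l g"
  have "g \<in> {-l..l} \<rightarrow>\<^sub>E {0..1}" using g unfolding truncated_solution_def by (rule conjunct1)
  then have g01: "0 \<le> g x" "g x \<le> 1" if "x \<in> {-l..l}" for x
    using PiE_mem[of g _ _ x] that by auto
  have f01: "0 \<le> ?f x" "?f x \<le> 1" for x
    using g01[of x] by (auto simp: extend_def)
  have eq: "?f x = exp_neg (nnpot ?f x)" if "x \<in> {-l..l}" for x
  proof -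
    have "?f x = g x" using that by (simp add: extend_def)
    also have "\<dots> = exp_neg (\<integral>\<^sup>+y\<in>{-x..l}. ennreal (d * (x + y) powr (d - 1) * g y) \<partial>lebesgue)"
      using g that unfolding truncated_solution_def by blast
    finally show ?thesis unfolding nnpot_extend[OF that] .
  qed
  have anti: "antimono ?f"
  proof (rule antimonoI)
    fix x y :: real assume xy: "x \<le> y"
    consider "x < - l" | "y > l" | "x \<in> {-l..l}" "y \<in> {-l..l}" using xy
      by (metis atLeastAtMost_iff linorder_not_le order_trans)
    then show "?f y \<le> ?f x"
    proof cases
      case 3
      then show ?thesis using exp_neg_antimono[OF nnpot_mono[OF f01(1) xy]] by (simp only: eq)
    qed (use f01[of x] f01[of y] xy l in \<open>auto simp: extend_def\<close>)
  qed
  have t: "tame ?f"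
    by (rule tame_antimono_support[OF anti f01, of l]) (use l in \<open>auto simp: extend_def\<close>)
  show ?thesis
  proof (rule solvesI[OF t])
    fix x
    consider "x < - l" | "x > l" | "x \<in> {-l..l}" by force
    then show "?f x = indicator {..l} x * exp (- pot ?f x)"
    proof cases
      case 1
      then show ?thesis using pot_eq_0[of l ?f x] l by (auto simp: extend_def)
    next
      case 2
      then show ?thesis using l by (auto simp: extend_def)
    next
      case 3
      then show ?thesis using eq[OF 3] exp_neg_nnpot[OF t, of x] by simp
    qed
  qed
qed

text \<open>A solution on \<open>{..l}\<close> equals 1 left of \<open>-l\<close> and 0 beyond
  \<open>l\<close>, so extending its restriction recovers it.\<close>

lemma truncated_solution_restrict:
  assumes f: "solves {..l} f" and l: "l > 0"
  shows "truncated_solution d l (restrict f {-l..l})"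
proof -
  note t = solvesD(1)[OF f]
  note [measurable] = tameD(1)[OF t]
  have ext: "extend l (restrict f {-l..l}) = f"
  proof
    fix x
    consider "x < - l" | "x > l" | "x \<in> {-l..l}" by force
    then show "extend l (restrict f {-l..l}) x = f x"
    proof cases
      case 1
      have "pot f x = 0"
      proof (rule pot_eq_0[of l])
        show "f y = 0" if "y > l" for y using that by (subst solvesD(2)[OF f]) simp
      qed (use 1 in simp)
      then show ?thesis using 1 l by (subst solvesD(2)[OF f]) (simp add: extend_def)
    next
      case 2
      then show ?thesis using l by (subst solvesD(2)[OF f]) (simp add: extend_def)
    qed (auto simp: extend_def)
  qed
  show ?thesis
    unfolding truncated_solution_def
  proof (intro conjI ballI)
    show "restrict f {-l..l} \<in> {-l..l} \<rightarrow>\<^sub>E {0..1}"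
      using tameD[OF t] by auto
    have "f \<in> borel_measurable (lebesgue_on {-l..l})"
      by (intro measurable_restrict_space1 measurable_completion) simp
    then show "restrict f {-l..l} \<in> borel_measurable (lebesgue_on {-l..l})"
      by (subst measurable_cong[where g = f]) auto
    fix x assume x: "x \<in> {-l..l}"
    show "restrict f {-l..l} x = exp_neg (\<integral>\<^sup>+y\<in>{-x..l}. ennreal (d * (x + y) powr (d - 1) *
        restrict f {-l..l} y) \<partial>lebesgue)"
      unfolding nnpot_extend[OF x] ext exp_neg_nnpot[OF t]
      using x solvesD(2)[OF f, of x] by simp
  qed
qed

lemma kern_double: "kern (2 * s) = 2 powr (d - 1) * kern s"
proof -
  have "max 0 (2 * s) = 2 * max 0 s" by (auto simp: max_def)
  then show ?thesis by (simp add: kern_def powr_mult)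
qed

text \<open>An everywhere infinite exponent would give \<open>f = 0\<close>, whose exponent is 0. So
  the exponent is finite somewhere, and homogeneity of the kernel spreads finiteness to every
  point.\<close>

lemma solves_cavity_solution:
  assumes f: "cavity_solution d f"
  shows "solves UNIV f"
proof -
  have "f \<in> UNIV \<rightarrow> {0..1}" using f unfolding cavity_solution_def by (rule conjunct1)
  then have f01: "0 \<le> f x" "f x \<le> 1" for x
    by (auto simp: Pi_iff)
  have eq: "f x = exp_neg (nnpot f x)" for x
    using f unfolding cavity_solution_def nnpot_atLeast by blast
  have anti: "antimono f"
  proof (rule antimonoI)
    fix x y :: real assume "x \<le> y"
    from exp_neg_antimono[OF nnpot_mono[of f, OF f01(1) this]]
    show "f y \<le> f x" unfolding eq[symmetric] .
  qed
  note m [measurable] = antimono_borel_measurable[OF anti]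
  obtain a where a: "nnpot f a < \<infinity>"
  proof (cases "\<exists>a. nnpot f a < \<infinity>")
    case False
    then have "nnpot f x = \<infinity>" for x by (metis infinity_ennreal_def less_top)
    then have "f x = 0" for x by (subst eq) (simp add: exp_neg_def)
    then have "nnpot f 0 = 0" by (simp add: nnpot_def)
    with False show ?thesis by (metis ennreal_zero_less_top infinity_ennreal_def)
  qed blast
  have fin: "nnpot f x < \<infinity>" for x
  proof -
    \<comment> \<open>Beyond \<open>x - 2 * a\<close> one has
      \<open>x + y \<le> 2 * (a + y)\<close>, so \<open>kern_double\<close> compares the kernels;
      the other term makes \<open>{-x..p}\<close> non-empty.\<close>
    define p where "p = max (x - 2 * a) (- x)"
    have le: "kern (x + y) * f y \<le> kern (x + p) * indicator {-x..p} y + 2 powr (d - 1) * (kern (a + y) * f y)" for y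
    proof -
      have nn: "0 \<le> 2 powr (d - 1) * (kern (a + y) * f y)" using f01 by simp
      consider "y < - x" | "y \<in> {-x..p}" | "y > p" by force
      then show ?thesis
      proof cases
        case 2
        have "kern (x + y) * f y \<le> kern (x + p) * 1"
          using 2 f01 by (intro mult_mono kern_mono) auto
        then show ?thesis using nn 2 by simp
      next
        case 3
        then have "kern (x + y) \<le> kern (2 * (a + y))" by (intro kern_mono) (auto simp: p_def)
        from mult_right_mono[OF this f01(1)[of y], unfolded kern_double mult.assoc] show ?thesis
          using 3 by simp
      qed (use nn in auto)
    qed
    have "nnpot f x \<le> (\<integral>\<^sup>+y. ennreal (kern (x + p)) * indicator {-x..p} y +
        ennreal (2 powr (d - 1)) * ennreal (kern (a + y) * f y) \<partial>lborel)"
      unfolding nnpot_def nn_integral_completion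
    proof (rule nn_integral_mono)
      fix y
      have "ennreal (kern (x + y) * f y) \<le>
        ennreal (kern (x + p) * indicator {-x..p} y + 2 powr (d - 1) * (kern (a + y) * f y))"
        by (rule ennreal_leI[OF le])
      also have "\<dots> = ennreal (kern (x + p)) * indicator {-x..p} y +
        ennreal (2 powr (d - 1)) * ennreal (kern (a + y) * f y)"
        using f01 by (simp add: ennreal_plus ennreal_mult ennreal_indicator)
      finally show "ennreal (kern (x + y) * f y) \<le> ennreal (kern (x + p)) * indicator {-x..p} y +
        ennreal (2 powr (d - 1)) * ennreal (kern (a + y) * f y)" .
    qed
    also have "\<dots> = ennreal (kern (x + p)) * emeasure lborel {-x..p} + ennreal (2 powr (d - 1)) * nnpot f a"
      unfolding nnpot_def nn_integral_completion
      by (subst nn_integral_add) (auto simp: nn_integral_cmult nn_integral_cmult_indicator)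
    also have "\<dots> < \<infinity>"
      using a by (simp add: ennreal_mult_less_top p_def)
    finally show ?thesis .
  qed
  have "integrable lborel (\<lambda>y. kern (x + y) * f y)" for x
    using fin[of x] f01 unfolding nnpot_def nn_integral_completion
    by (intro integrableI_nonneg) auto
  then have t: "tame f" using f01 by (auto simp: tame_def m)
  show ?thesis
  proof (rule solvesI[OF t])
    show "f x = indicator UNIV x * exp (- pot f x)" for x
      using eq[of x] exp_neg_nnpot[OF t, of x] by simp
  qed
qed

lemma cavity_solution_solves:
  assumes f: "solves UNIV f"
  shows "cavity_solution d f"
proof -
  note t = solvesD(1)[OF f]
  note [measurable] = tameD(1)[OF t]
  show ?thesis
    unfolding cavity_solution_def nnpot_atLeast exp_neg_nnpot[OF t]
  proof (intro conjI allI)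
    show "f \<in> borel_measurable lebesgue" by (rule measurable_completion) simp
    show "f x = exp (- pot f x)" for x using solvesD(2)[OF f, of x] by simp
  qed (use tameD[OF t] in auto)
qed

end

context pseudo_dimension
begin

subsection \<open>Passage to the limit\<close>

lemma kern_le_weight: "kern (x + y) \<le> d * (1 + \<bar>x\<bar>) powr (d - 1) * weight y"
proof -
  have "\<bar>x\<bar> * 1 \<le> \<bar>x\<bar> * max 1 \<bar>y\<bar>" by (intro mult_left_mono) auto
  then have "max 0 (x + y) \<le> (1 + \<bar>x\<bar>) * max 1 \<bar>y\<bar>"
    unfolding distrib_right by linarith
  then have "max 0 (x + y) powr (d - 1) \<le> (1 + \<bar>x\<bar>) powr (d - 1) * weight y"
    unfolding weight_def using d_gt_1 by (subst powr_mult[symmetric]) (auto intro!: powr_mono2)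
  then show ?thesis
    using d_gt_1 by (simp add: kern_def mult.assoc)
qed

text \<open>A common majorant of all solutions, independent of the truncation, for use in dominated
  convergence.\<close>

definition envelope :: "real \<Rightarrow> real" where
  "envelope y = (if y < 0 then 1 else exp (- (exp (- 1) * \<bar>y\<bar> powr d)))"

lemma envelope_integrable: "integrable lborel (\<lambda>y. kern (x + y) * envelope y)"
proof (rule Bochner_Integration.integrable_bound)
  let ?C = "d * (1 + \<bar>x\<bar>) powr (d - 1)"
  let ?e = "\<lambda>y. exp (- (exp (- 1) * \<bar>y\<bar> powr d))"
  have "integrable lborel (\<lambda>y. kern (x + y) * indicator {- \<bar>x\<bar>..0} y)"
    using kern_integral[of "- \<bar>x\<bar>" 0 x] by (simp add: has_bochner_integral_iff)
  then show "integrable lborel (\<lambda>y. kern (x + y) * indicator {- \<bar>x\<bar>..0} y + ?C * (weight y * ?e y))"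
    by (intro Bochner_Integration.integrable_add Bochner_Integration.integrable_mult_right
        weight_exp_integrable) auto
  show "(\<lambda>y. kern (x + y) * envelope y) \<in> borel_measurable lborel"
    unfolding envelope_def by measurable
  show "AE y in lborel. norm (kern (x + y) * envelope y) \<le>
      norm (kern (x + y) * indicator {- \<bar>x\<bar>..0} y + ?C * (weight y * ?e y))"
  proof (intro AE_I2)
    fix y
    have nn: "0 \<le> ?C * (weight y * ?e y)"
      using d_gt_1 weight_ge_1[of y] by (intro mult_nonneg_nonneg) auto
    have "kern (x + y) * envelope y \<le> kern (x + y) * indicator {- \<bar>x\<bar>..0} y + ?C * (weight y * ?e y)"
    proof (cases "y < 0")
      case True
      have "kern (x + y) * envelope y \<le> kern (x + y) * indicator {- \<bar>x\<bar>..0} y"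
        using True by (cases "y < - x") (auto simp: envelope_def)
      with nn show ?thesis by linarith
    next
      case False
      have "kern (x + y) * ?e y \<le> ?C * weight y * ?e y"
        by (intro mult_right_mono kern_le_weight) auto
      moreover have "0 \<le> kern (x + y) * indicator {- \<bar>x\<bar>..0} y" by simp
      ultimately show ?thesis using False by (simp only: envelope_def if_False mult.assoc)
    qed
    then show "norm (kern (x + y) * envelope y) \<le>
      norm (kern (x + y) * indicator {- \<bar>x\<bar>..0} y + ?C * (weight y * ?e y))"
      by (simp add: envelope_def abs_mult)
  qed
qed

lemma solves_le_envelope:
  assumes f: "solves A f" and A: "\<And>x y. x \<le> y \<Longrightarrow> y \<in> A \<Longrightarrow> x \<in> A" "0 \<in> A"
  shows "f y \<le> envelope y"
  using solves_tail(1)[where x = y, OF f A] tameD(3)[OF solvesD(1)[OF f], of y]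
  by (auto simp: envelope_def)

text \<open>Helly's theorem gives convergence off a countable set. By dominated convergence the
  potentials then converge at every point, and the equation turns this into convergence of the
  functions everywhere.\<close>

lemma truncated_subsequence:
  fixes l :: "nat \<Rightarrow> real"
  assumes l: "filterlim l at_top sequentially" "\<And>n. l n > 0"
    and f: "\<And>n. solves {..l n} (f n)"
  shows "\<exists>s F. strict_mono s \<and> solves UNIV F \<and> (\<forall>x. (\<lambda>n. f (s n) x) \<longlonglongrightarrow> F x)"
proof -
  note t = solvesD(1)[OF f]
  note [measurable] = tameD(1)[OF t]
  have A: "x \<in> {..l n}" if "x \<le> y" "y \<in> {..l n}" for x y n using that by auto
  have 0: "0 \<in> {..l n}" for n using l(2)[of n] by simp
  have env: "f n y \<le> envelope y" for n y
    by (rule solves_le_envelope[OF f A 0])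
  \<comment> \<open>Helly's theorem is stated for non-decreasing right-continuous functions, hence
    the reflection. The solutions are left-continuous because \<open>{..l n}\<close> contains its
    end point.\<close>
  define h where "h n x = f n (- x)" for n x
  have "\<exists>s. strict_mono (s::nat \<Rightarrow> nat) \<and> (\<exists>G. (\<forall>x. continuous (at_right x) G) \<and> mono G \<and>
      (\<forall>x. \<bar>G x\<bar> \<le> 1) \<and> (\<forall>x. continuous (at x) G \<longrightarrow> (\<lambda>n. h (s n) x) \<longlonglongrightarrow> G x))"
  proof (rule Helly_selection)
    fix n
    show "mono (h n)"
      using solves_antimono[OF f A, of n] by (auto simp: mono_def antimono_def h_def)
    show "\<bar>h n x\<bar> \<le> 1" for x
      using tameD(2,3)[OF t, of n "- x"] by (simp add: h_def)
    show "continuous (at_right x) (h n)" for x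
    proof (cases "x < - l n")
      case True
      then have z: "h n y = 0" if "y < - l n" for y
        unfolding h_def using that by (subst solvesD(2)[OF f]) simp
      have "\<forall>\<^sub>F y in at_right x. h n y = 0"
        by (rule eventually_at_rightI[OF z True]) simp
      then show ?thesis
        unfolding continuous_within z[OF True] by (rule tendsto_eventually)
    next
      case False
      have e: "h n y = exp (- pot (f n) (- y))" if "y \<ge> - l n" for y
        unfolding h_def using that by (subst solvesD(2)[OF f]) simp
      have "isCont (\<lambda>y. pot (f n) (- y)) x"
        by (rule isCont_o2[OF _ isCont_pot[OF t]]) (auto intro!: continuous_intros)
      then have "((\<lambda>y. exp (- pot (f n) (- y))) \<longlongrightarrow> h n x) (at_right x)"
        using False unfolding isCont_def
        by (subst e) (auto intro!: tendsto_intros intro: tendsto_within_subset)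
      moreover have "\<forall>\<^sub>F y in at_right x. exp (- pot (f n) (- y)) = h n y"
        using eventually_at_right_less[of x] by eventually_elim (use False e in auto)
      ultimately show ?thesis
        unfolding continuous_within by (rule Lim_transform_eventually)
    qed
  qed
  then obtain s G where s: "strict_mono s" and G: "mono G"
    "\<And>x. \<bar>G x\<bar> \<le> 1" "\<And>x. isCont G x \<Longrightarrow> (\<lambda>n. h (s n) x) \<longlonglongrightarrow> G x"
    by blast
  \<comment> \<open>Helly's theorem bounds only the absolute value; cutting at 0 restores the range
    \<open>{0..1}\<close> and changes nothing where convergence holds.\<close>
  define H where "H y = max 0 (G (- y))" for y
  note [measurable] = borel_measurable_mono[OF G(1)]
  have Hm [measurable]: "H \<in> borel_measurable borel" unfolding H_def[abs_def] by measurable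
  have conv: "AE y in lborel. (\<lambda>n. f (s n) y) \<longlonglongrightarrow> H y"
  proof -
    have "countable (uminus ` {a. \<not> isCont G a})"
      by (intro countable_image mono_ctble_discont G)
    then have "AE y in lborel. y \<notin> uminus ` {a. \<not> isCont G a}"
      by (intro AE_not_in countable_imp_null_set_lborel)
    then show ?thesis
    proof eventually_elim
      case (elim y)
      then have "isCont G (- y)" by (metis (mono_tags) image_eqI mem_Collect_eq minus_minus)
      from tendsto_max[OF tendsto_const[of 0] G(3)[OF this]]
      have "(\<lambda>n. max 0 (f (s n) y)) \<longlonglongrightarrow> H y" by (simp add: h_def H_def)
      then show ?case using tameD(2)[OF t] by (simp add: max_absorb2)
    qed
  qed
  have dom: "integrable lborel (\<lambda>y. kern (x + y) * H y)"
    "(\<lambda>n. pot (f (s n)) x) \<longlonglongrightarrow> pot H x" for x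
  proof -
    have c: "AE y in lborel. (\<lambda>n. kern (x + y) * f (s n) y) \<longlonglongrightarrow> kern (x + y) * H y"
      using conv by eventually_elim (intro tendsto_intros)
    have b: "AE y in lborel. norm (kern (x + y) * f (s n) y) \<le> kern (x + y) * envelope y" for n
      using tameD(2)[OF t] env by (intro AE_I2) (auto simp: abs_mult intro!: mult_left_mono)
    show "integrable lborel (\<lambda>y. kern (x + y) * H y)"
      by (rule integrable_dominated_convergence[OF _ _ envelope_integrable c b]) auto
    show "(\<lambda>n. pot (f (s n)) x) \<longlonglongrightarrow> pot H x"
      unfolding pot_def
      by (rule integral_dominated_convergence[OF _ _ envelope_integrable c b]) auto
  qed
  \<comment> \<open>\<open>H\<close> is the limit only almost everywhere; applying the equation once
    produces a version that is the limit everywhere.\<close>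
  define F where "F x = exp (- pot H x)" for x
  have ls: "filterlim (\<lambda>n. l (s n)) at_top sequentially"
    by (rule filterlim_compose[OF l(1) filterlim_subseq[OF s]])
  have lim: "(\<lambda>n. f (s n) x) \<longlonglongrightarrow> F x" for x
  proof (rule Lim_transform_eventually)
    show "(\<lambda>n. exp (- pot (f (s n)) x)) \<longlonglongrightarrow> F x"
      unfolding F_def by (intro tendsto_intros dom)
    have "\<forall>\<^sub>F n in sequentially. x \<le> l (s n)"
      using ls by (simp add: filterlim_at_top)
    then show "\<forall>\<^sub>F n in sequentially. exp (- pot (f (s n)) x) = f (s n) x"
      by eventually_elim (subst solvesD(2)[OF f], simp)
  qed
  have HF: "AE y in lborel. H y = F y"
    using conv by eventually_elim (rule LIMSEQ_unique[OF _ lim])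
  have tH: "tame H"
    using G(2) dom(1) Hm by (auto simp: tame_def H_def abs_le_iff)
  have Fm [measurable]: "F \<in> borel_measurable borel"
    unfolding F_def[abs_def]
    by (intro borel_measurable_continuous_onI continuous_intros continuous_on_pot tH)
  have potF: "pot F x = pot H x" for x
    unfolding pot_def by (rule integral_cong_AE) (use HF in auto)
  have "integrable lborel (\<lambda>y. kern (x + y) * F y)" for x
    using dom(1)[of x] by (rule integrable_cong_AE_imp) (use HF in auto)
  then have "tame F"
    using Fm pot_nonneg[OF tH] by (auto simp: tame_def F_def)
  then have "solves UNIV F"
    by (rule solvesI) (simp add: potF, simp add: F_def)
  with s lim show ?thesis by blast
qed

lemma solution_exists: "\<exists>F. solves UNIV F"
proof -
  have "\<forall>n. \<exists>f. solves {..real (Suc n)} f" by (intro allI truncated_exists) simp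
  then obtain f where f: "\<And>n. solves {..real (Suc n)} (f n)" by metis
  have "filterlim (\<lambda>n. real (Suc n)) at_top sequentially"
    by (rule filterlim_compose[OF filterlim_real_sequentially filterlim_Suc])
  from truncated_subsequence[OF this _ f] show ?thesis by auto
qed

text \<open>Otherwise some lengths tending to infinity keep \<open>F l x\<close> away from
  \<open>f x\<close>, yet a subsequence converges to a solution on the line, which is
  \<open>f\<close> by uniqueness.\<close>

lemma truncated_tendsto:
  assumes f: "solves UNIV f" and F: "\<And>l. l > 0 \<Longrightarrow> solves {..l} (F l)"
  shows "((\<lambda>l. F l x) \<longlongrightarrow> f x) at_top"
proof (rule ccontr)
  assume "\<not> ?thesis"
  then obtain e where e: "e > 0" "\<not> (\<forall>\<^sub>F l in at_top. dist (F l x) (f x) < e)"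
    unfolding tendsto_iff by blast
  have "\<exists>l>real n. \<not> dist (F l x) (f x) < e" for n
    using e(2) unfolding eventually_at_top_dense by blast
  then obtain l where l: "\<And>n. l n > real n" "\<And>n. \<not> dist (F (l n) x) (f x) < e" by metis
  have l0: "l n > 0" for n using l(1)[of n] by linarith
  have "filterlim l at_top sequentially"
    by (rule filterlim_at_top_mono[OF filterlim_real_sequentially])
       (intro always_eventually allI less_imp_le l)
  from truncated_subsequence[OF this l0 F[OF l0]]
  obtain s G where G: "solves UNIV G" "(\<lambda>n. F (l (s n)) x) \<longlonglongrightarrow> G x" by blast
  have "G = f" by (rule solution_unique[OF G(1) f])
  with G(2) e(1) have "\<forall>\<^sub>F n in sequentially. dist (F (l (s n)) x) (f x) < e"
    unfolding tendsto_iff by blast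
  then show False using l(2) by (auto dest: eventually_happens)
qed

section \<open>Convergence of the entropy integrals\<close>

lemma entropy_bound:
  assumes f: "solves A f" and A: "\<And>x y. x \<le> y \<Longrightarrow> y \<in> A \<Longrightarrow> x \<in> A" "0 \<in> A"
  shows "\<bar>f y * ln (f y)\<bar> \<le> exp 1 * exp (- (exp (- 1) / 2 * \<bar>y\<bar> powr d))"
proof (cases "y \<in> A")
  case False
  then have "f y = 0" by (subst solvesD(2)[OF f]) simp
  then show ?thesis by simp
next
  case True
  note t = solvesD(1)[OF f]
  have fy: "f y = exp (- pot f y)" using True by (subst solvesD(2)[OF f]) simp
  have eq: "\<bar>f y * ln (f y)\<bar> = f y * pot f y"
    unfolding fy using pot_nonneg[OF t, of y] by (simp add: abs_mult)
  show ?thesis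
  proof (cases "y \<ge> 0")
    case True
    \<comment> \<open>Half of the exponent absorbs the factor \<open>pot f y\<close>; the other half
      supplies the decay, whence the rate \<open>exp (- 1) / 2\<close>.\<close>
    have "pot f y / 2 \<le> exp (pot f y / 2)"
      using exp_ge_add_one_self[of "pot f y / 2"] by linarith
    then have "f y * pot f y \<le> f y * (2 * exp (pot f y / 2))"
      using tameD(2)[OF t] by (intro mult_left_mono) auto
    also have "\<dots> = 2 * exp (- (pot f y) / 2)"
      unfolding fy by (simp add: exp_add[symmetric])
    also have "\<dots> \<le> exp 1 * exp (- (exp (- 1) / 2 * \<bar>y\<bar> powr d))"
    proof (intro mult_mono)
      show "(2::real) \<le> exp 1" using exp_ge_add_one_self[of "1::real"] by simp
      show "exp (- (pot f y) / 2) \<le> exp (- (exp (- 1) / 2 * \<bar>y\<bar> powr d))"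
        using solves_tail(1)[OF f A True] True unfolding fy by simp
    qed auto
    finally show ?thesis unfolding eq .
  next
    case False
    have "f y * pot f y \<le> pot f y"
      using tameD(2,3)[OF t, of y] pot_nonneg[OF t, of y] by (intro mult_left_le_one_le) auto
    also have "\<dots> \<le> exp 1 * exp (- (exp (- 1) * \<bar>y\<bar> powr d))"
      by (rule solves_tail(2)[OF f A]) (use False in auto)
    also have "\<dots> \<le> exp 1 * exp (- (exp (- 1) / 2 * \<bar>y\<bar> powr d))" by simp
    finally show ?thesis unfolding eq .
  qed
qed

lemma entropy_envelope_integrable:
  "integrable lborel (\<lambda>y. exp 1 * exp (- (exp (- 1) / 2 * \<bar>y\<bar> powr d)))"
  by (intro Bochner_Integration.integrable_mult_right, rule weight_integrable_imp[OF _ weight_exp_integrable])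
     auto

lemma entropy_integrable:
  assumes f: "solves A f" and A: "\<And>x y. x \<le> y \<Longrightarrow> y \<in> A \<Longrightarrow> x \<in> A" "0 \<in> A"
  shows "integrable lborel (\<lambda>y. f y * ln (f y))"
proof (rule Bochner_Integration.integrable_bound[OF entropy_envelope_integrable])
  note [measurable] = tameD(1)[OF solvesD(1)[OF f]]
  show "(\<lambda>y. f y * ln (f y)) \<in> borel_measurable lborel" by measurable
  show "AE y in lborel. norm (f y * ln (f y)) \<le> norm (exp 1 * exp (- (exp (- 1) / 2 * \<bar>y\<bar> powr d)))"
    using entropy_bound[OF f A] by (intro AE_I2) (simp only: real_norm_def abs_mult abs_exp_cancel)
qed

lemma entropy_tendsto:
  assumes f: "solves UNIV f" and F: "\<And>l. l > 0 \<Longrightarrow> solves {..l} (F l)"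
  shows "((\<lambda>l. \<integral>y. F l y * ln (F l y) \<partial>lborel) \<longlongrightarrow> (\<integral>y. f y * ln (f y) \<partial>lborel)) at_top"
proof (rule Lim_transform_eventually)
  \<comment> \<open>This gives a solution for every index \<open>l\<close>, since measurability is
    required for all \<open>l\<close> and not only for large ones.\<close>
  define G where "G l = F (max 1 l)" for l
  have G: "solves {..max 1 l} (G l)" for l unfolding G_def by (intro F) simp
  note [measurable] = tameD(1)[OF solvesD(1)[OF G]] tameD(1)[OF solvesD(1)[OF f]]
  have ev: "\<forall>\<^sub>F l in at_top. G l = F l"
    using eventually_ge_at_top[of 1] by eventually_elim (simp add: G_def max_def)
  show "((\<lambda>l. \<integral>y. G l y * ln (G l y) \<partial>lborel) \<longlongrightarrow> (\<integral>y. f y * ln (f y) \<partial>lborel)) at_top"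
  proof (rule integral_dominated_convergence_at_top[OF _ _ entropy_envelope_integrable])
    show "AE y in lborel. ((\<lambda>l. G l y * ln (G l y)) \<longlongrightarrow> f y * ln (f y)) at_top"
    proof (intro AE_I2)
      fix y
      have "((\<lambda>l. G l y) \<longlongrightarrow> f y) at_top"
        by (rule Lim_transform_eventually[OF truncated_tendsto[OF f F]])
           (use ev in \<open>auto elim!: eventually_mono\<close>)
      moreover have "f y > 0" by (subst solvesD(2)[OF f]) simp
      ultimately show "((\<lambda>l. G l y * ln (G l y)) \<longlongrightarrow> f y * ln (f y)) at_top"
        by (intro tendsto_intros) auto
    qed
    show "\<forall>\<^sub>F l in at_top. AE y in lborel. norm (G l y * ln (G l y)) \<le> exp 1 * exp (- (exp (- 1) / 2 * \<bar>y\<bar> powr d))"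
      unfolding real_norm_def
      by (intro always_eventually allI AE_I2 entropy_bound[OF G]) auto
  qed auto
  show "\<forall>\<^sub>F l in at_top. (\<integral>y. G l y * ln (G l y) \<partial>lborel) = (\<integral>y. F l y * ln (F l y) \<partial>lborel)"
    using ev by eventually_elim simp
qed

text \<open>Outside the interval the extension takes the values 1 and 0, and both contribute nothing
  to the entropy.\<close>

lemma truncated_entropy_extend:
  fixes g :: "real \<Rightarrow> real"
  shows "indicator {-l..l} x *\<^sub>R (g x * ln (g x)) = extend l g x * ln (extend l g x)"
  by (cases "x < - l"; cases "x \<le> l") (simp_all add: extend_def)

lemma truncated_solution_unique:
  assumes l: "l > 0" and g: "truncated_solution d l g" and h: "truncated_solution d l h"
  shows "g = h"
proof -
  have "extend l g = extend l h"
    by (rule truncated_unique[OF l solves_extend[OF g l] solves_extend[OF h l]])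
  then have "extend l g x = extend l h x" for x by simp
  then have "g x = h x" if "x \<in> {-l..l}" for x
    using that by (force simp: extend_def dest: spec[of _ x])
  moreover have "g \<in> {-l..l} \<rightarrow>\<^sub>E {0..1}" "h \<in> {-l..l} \<rightarrow>\<^sub>E {0..1}"
    using conjunct1[OF g[unfolded truncated_solution_def]] conjunct1[OF h[unfolded truncated_solution_def]] .
  ultimately show ?thesis by (intro PiE_ext)
qed

end

text \<open>The integrability claims exclude that the Bochner integrals are default zeros; the last
  limit is the coincidence of the two quantities.\<close>

theorem theorem1:
  fixes d :: real
  assumes "d > 1"
  shows "(\<exists>!f. cavity_solution d f) \<and>
    (\<forall>l>0. \<exists>!g. truncated_solution d l g) \<and>
    (\<forall>(f :: real \<Rightarrow> real) (F :: real \<Rightarrow> real \<Rightarrow> real).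
       cavity_solution d f \<and> (\<forall>l>0. truncated_solution d l (F l)) \<longrightarrow>
         (\<forall>x. ((\<lambda>l. F l x) \<longlongrightarrow> f x) at_top) \<and>
         (\<forall>l>0. set_integrable lebesgue {-l..l} (\<lambda>x. F l x * ln (F l x))) \<and>
         integrable lebesgue (\<lambda>x. f x * ln (f x)) \<and>
         ((\<lambda>l. LINT x:{-l..l}|lebesgue. F l x * ln (F l x))
            \<longlongrightarrow> (LINT x|lebesgue. f x * ln (f x))) at_top \<and>
         ((\<lambda>l. - d * (LINT x:{-l..l}|lebesgue. F l x * ln (F l x)))
            \<longlongrightarrow> - d * (LINT x|lebesgue. f x * ln (f x))) at_top)"
proof -
  interpret pseudo_dimension d by unfold_locales (rule assms)
  show ?thesis
  proof (intro conjI allI impI)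
    show "\<exists>!f. cavity_solution d f"
    proof (rule ex_ex1I)
      show "\<exists>f. cavity_solution d f"
        using solution_exists cavity_solution_solves by blast
      show "f = g" if "cavity_solution d f" "cavity_solution d g" for f g
        by (intro solution_unique solves_cavity_solution that)
    qed
    show "\<exists>!g. truncated_solution d l g" if "l > 0" for l
    proof (rule ex_ex1I)
      show "\<exists>g. truncated_solution d l g"
        using truncated_exists[OF that] truncated_solution_restrict[OF _ that] by blast
      show "g = h" if "truncated_solution d l g" "truncated_solution d l h" for g h
        by (rule truncated_solution_unique[OF \<open>l > 0\<close> that])
    qed
  next
    fix f :: "real \<Rightarrow> real" and F :: "real \<Rightarrow> real \<Rightarrow> real"
    assume asm: "cavity_solution d f \<and> (\<forall>l>0. truncated_solution d l (F l))"
    have f: "solves UNIV f" using asm by (intro solves_cavity_solution) simp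
    have F: "solves {..l} (extend l (F l))" if "l > 0" for l
      by (rule solves_extend[OF _ that]) (use asm that in blast)
    note fm = tameD(1)[OF solvesD(1)[OF f]]
    have m: "(\<lambda>x. g x * ln (g x)) \<in> borel_measurable lborel" if "g \<in> borel_measurable borel" for g :: "real \<Rightarrow> real"
      using that by simp
    \<comment> \<open>The extension is Borel, and for Borel integrands the integral over the
      completed measure agrees with the one over \<open>lborel\<close>.\<close>
    have entF: "(LINT x:{-l..l}|lebesgue. F l x * ln (F l x)) =
        (\<integral>x. extend l (F l) x * ln (extend l (F l) x) \<partial>lborel)" if "l > 0" for l
      unfolding set_lebesgue_integral_def truncated_entropy_extend
      by (rule integral_completion[OF m[OF tameD(1)[OF solvesD(1)[OF F[OF that]]]]])
    have entf: "(LINT x|lebesgue. f x * ln (f x)) = (\<integral>x. f x * ln (f x) \<partial>lborel)"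
      by (rule integral_completion[OF m[OF fm]])
    show "((\<lambda>l. F l x) \<longlongrightarrow> f x) at_top" for x
    proof (rule Lim_transform_eventually[OF truncated_tendsto[OF f F]])
      show "\<forall>\<^sub>F l in at_top. extend l (F l) x = F l x"
        using eventually_ge_at_top[of "\<bar>x\<bar>"] by eventually_elim (auto simp: extend_def)
    qed
    show "set_integrable lebesgue {-l..l} (\<lambda>x. F l x * ln (F l x))" if "l > 0" for l
      unfolding set_integrable_def truncated_entropy_extend
      by (subst integrable_completion[OF m[OF tameD(1)[OF solvesD(1)[OF F[OF that]]]]],
          rule entropy_integrable[OF F[OF that]]) (use that in auto)
    show "integrable lebesgue (\<lambda>x. f x * ln (f x))"
      by (subst integrable_completion[OF m[OF fm]], rule entropy_integrable[OF f]) auto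
    show lim: "((\<lambda>l. LINT x:{-l..l}|lebesgue. F l x * ln (F l x))
        \<longlongrightarrow> (LINT x|lebesgue. f x * ln (f x))) at_top"
      unfolding entf
    proof (rule Lim_transform_eventually[OF entropy_tendsto[OF f F]])
      show "\<forall>\<^sub>F l in at_top. (\<integral>x. extend l (F l) x * ln (extend l (F l) x) \<partial>lborel) =
          (LINT x:{-l..l}|lebesgue. F l x * ln (F l x))"
        using eventually_gt_at_top[of 0] by eventually_elim (simp add: entF)
    qed
    show "((\<lambda>l. - d * (LINT x:{-l..l}|lebesgue. F l x * ln (F l x)))
        \<longlongrightarrow> - d * (LINT x|lebesgue. f x * ln (f x))) at_top"
      by (intro tendsto_mult tendsto_const lim)
  qed
qed

end
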